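(* Let $(X,R)$ be an infinite ultrahomogeneous cyclically ordered set, equipped with the interval topology $\tau_R$, whose base consists of all intervals $(a,b)$, $a,b\in X$. Let $H=(\mathrm{Aut}(X,R),\tau_p)$ be the automorphism group of $(X,R)$ endowed with the topology $\tau_p$ of pointwise convergence for its action on $(X,\tau_R)$. Then the WAP compactification $wH$ is trivial, i.e. consists of a single point.
   Context: Cyclic orders. A cyclically ordered (c.o.) set $(X,R)$, $|X|\ge 3$, is a set with a ternary relation $R=[\cdot,\cdot,\cdot]$ satisfying: cyclicity $[a,b,c]\Rightarrow[b,c,a]$; asymmetry $[a,b,c]\Rightarrow\neg[b,a,c]$; transitivity $[a,b,c]\wedge[a,c,d]\Rightarrow[a,b,d]$; completeness: for pairwise distinct $a,b,c$ either $[a,b,c]$ or $[a,c,b]$. A tuple $(x_1,\dots,x_n)$, $n\ge3$, is a cycle if $[x_i,x_j,x_k]$ for all $i<j<k$; a tuple of length 1 is a cycle; a pair $(x_1,x_2)$ is a cycle if $x_1\ne x_2$. Intervals: $(a,b)=\{x\in X: [a,x,b]\}$. $\mathrm{Aut}(X,R)$ is the group of bijections $f:X\to X$ with $[a,b,c]\iff[fa,fb,fc]$. $(X,R)$ is ultrahomogeneous if for every $n\in\mathbb N$ and any cycles $(x_1,\dots,x_n)$, $(y_1,\dots,y_n)$ in $X$ there is $g\in \mathrm{Aut}(X,R)$ with $gx_i=y_i$ for all $i$. It is known that $H$ is a topological group and that the action $H\curvearrowright(X,\tau_R)$ is continuous. WAP compactification. Let $C_b(H)$ be the $C^*$-algebra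 of bounded continuous functions $H\to\mathbb C$. For $\varphi\in C_b(H)$ and $g\in H$ put $\varphi_g(h)=\varphi(gh)$. The function $\varphi$ is weakly almost periodic if its orbit $\{\varphi_g: g\in H\}$ is relatively compact in the weak topology of the Banach space $C_b(H)$. $WAP(H)$ is the $C^*$-algebra of all weakly almost periodic functions, and $wH$ is its Gelfand space with the canonical map $H\to wH$ (in general not an embedding). It is the largest (improper) semitopological semigroup compactification of $H$: the largest compact Hausdorff semigroup with separately continuous multiplication admitting a continuous homomorphism from $H$ with dense image. *)

theory Defs
  imports "HOL-Analysis.Analysis" "HOL-Algebra.Group"
begin

section \<open>Cyclically ordered sets\<close>

text \<open>The underlying set is the whole type, as usual for a single ambient structure.\<close>

locale cyclic_order =
  fixes R :: "'a \<Rightarrow> 'a \<Rightarrow> 'a \<Rightarrow> bool"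
  assumes three_points: "\<exists>a b c :: 'a. a \<noteq> b \<and> b \<noteq> c \<and> a \<noteq> c"
    and cyclicity: "R a b c \<Longrightarrow> R b c a"
    and asymmetry: "R a b c \<Longrightarrow> \<not> R b a c"
    and transitivity: "R a b c \<Longrightarrow> R a c d \<Longrightarrow> R a b d"
    and completeness: "a \<noteq> b \<Longrightarrow> b \<noteq> c \<Longrightarrow> a \<noteq> c \<Longrightarrow> R a b c \<or> R a c b"

definition cycle_tuple :: "('a \<Rightarrow> 'a \<Rightarrow> 'a \<Rightarrow> bool) \<Rightarrow> 'a list \<Rightarrow> bool" where
  "cycle_tuple R xs \<longleftrightarrow>
     length xs = 1 \<or>
     (length xs = 2 \<and> xs ! 0 \<noteq> xs ! 1) \<or>
     (length xs \<ge> 3 \<and>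
       (\<forall>i j k. i < j \<and> j < k \<and> k < length xs \<longrightarrow> R (xs ! i) (xs ! j) (xs ! k)))"

definition cyclic_interval :: "('a \<Rightarrow> 'a \<Rightarrow> 'a \<Rightarrow> bool) \<Rightarrow> 'a \<Rightarrow> 'a \<Rightarrow> 'a set" where
  "cyclic_interval R a b = {x. R a x b}"

definition Aut :: "('a \<Rightarrow> 'a \<Rightarrow> 'a \<Rightarrow> bool) \<Rightarrow> ('a \<Rightarrow> 'a) set" where
  "Aut R = {f. bij f \<and> (\<forall>a b c. R a b c \<longleftrightarrow> R (f a) (f b) (f c))}"

definition ultrahomogeneous :: "('a \<Rightarrow> 'a \<Rightarrow> 'a \<Rightarrow> bool) \<Rightarrow> bool" where
  "ultrahomogeneous R \<longleftrightarrow>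
     (\<forall>xs ys. length xs = length ys \<and> cycle_tuple R xs \<and> cycle_tuple R ys
        \<longrightarrow> (\<exists>g\<in>Aut R. map g xs = ys))"

text \<open>The intervals are not merely a subbase but a base of this topology, see
  \<open>openin_interval_topology_iff\<close> below.\<close>

definition interval_topology :: "('a \<Rightarrow> 'a \<Rightarrow> 'a \<Rightarrow> bool) \<Rightarrow> 'a topology" where
  "interval_topology R = topology_generated_by {cyclic_interval R a b | a b. True}"

definition aut_group :: "('a \<Rightarrow> 'a \<Rightarrow> 'a \<Rightarrow> bool) \<Rightarrow> ('a \<Rightarrow> 'a) monoid" where
  "aut_group R = \<lparr>carrier = Aut R, mult = (\<circ>), one = id\<rparr>"

text \<open>Pointwise convergence is with respect to the interval topology, not the discrete one.\<close>

definition aut_topology :: "('a \<Rightarrow> 'a \<Rightarrow> 'a \<Rightarrow> bool) \<Rightarrow> ('a \<Rightarrow> 'a) topology" where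
  "aut_topology R =
     subtopology (product_topology (\<lambda>x. interval_topology R) UNIV) (Aut R)"

context cyclic_order
begin

lemma in_some_interval: "\<exists>a b. x \<in> cyclic_interval R a b"
proof -
  obtain y z where "y \<noteq> x" "z \<noteq> x" "y \<noteq> z"
    using three_points by metis
  then show ?thesis
    unfolding cyclic_interval_def mem_Collect_eq
    by (metis completeness cyclicity)
qed

lemma distinct_of: "R a b c \<Longrightarrow> a \<noteq> b \<and> b \<noteq> c \<and> a \<noteq> c"
  using asymmetry cyclicity by metis

lemma shrink_interval:
  assumes "x \<in> cyclic_interval R a b" "c \<noteq> x"
  shows "\<exists>e f. x \<in> cyclic_interval R e f \<and> cyclic_interval R e f \<subseteq> cyclic_interval R a b
    \<and> c \<notin> cyclic_interval R e f"
proof (cases "R a c b")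
  case False
  then show ?thesis using assms unfolding cyclic_interval_def by blast
next
  case True
  have x: "R a x b" using assms unfolding cyclic_interval_def by simp
  have irr: "\<not> R u v v" "\<not> R u u v" for u v
    using distinct_of by blast+
  consider "R a c x" | "R a x c"
    using completeness[of a c x] distinct_of[OF x] distinct_of[OF True] assms(2) by blast
  then show ?thesis
  proof cases
    case 1
    have "R c x b" by (meson 1 x cyclicity transitivity)
    moreover have "R a y b" if "R c y b" for y
      by (meson that True cyclicity transitivity)
    ultimately show ?thesis using irr unfolding cyclic_interval_def by blast
  next
    case 2
    have "R a y b" if "R a y c" for y
      by (meson that True transitivity)
    with 2 show ?thesis using irr unfolding cyclic_interval_def by blast
  qed
qed

lemma interval_inter:
  assumes "x \<in> cyclic_interval R a b" "x \<in> cyclic_interval R c d"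
  shows "\<exists>e f. x \<in> cyclic_interval R e f \<and>
    cyclic_interval R e f \<subseteq> cyclic_interval R a b \<inter> cyclic_interval R c d"
proof -
  have cxd: "R c x d" using assms unfolding cyclic_interval_def by simp
  obtain e' f' where 1: "x \<in> cyclic_interval R e' f'"
      "cyclic_interval R e' f' \<subseteq> cyclic_interval R a b" "c \<notin> cyclic_interval R e' f'"
    using shrink_interval[OF assms(1), of c] distinct_of[OF cxd] by blast
  obtain e f where 2: "x \<in> cyclic_interval R e f"
      "cyclic_interval R e f \<subseteq> cyclic_interval R e' f'" "d \<notin> cyclic_interval R e f"
    using shrink_interval[OF 1(1), of d] distinct_of[OF cxd] by blast
  have nc: "\<not> R e c f" and nd: "\<not> R e d f" and exf: "R e x f"
    using 1 2 unfolding cyclic_interval_def by auto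
  have "R c y d" if y: "R e y f" for y
  proof (rule ccontr)
    assume "\<not> R c y d"
    then have cdy: "R c d y"
      using completeness[of c d y] distinct_of[OF cxd] y nc nd by blast
    have xdy: "R x d y" and yxc: "R y c x"
      by (meson cxd cdy cyclicity transitivity)+
    have ne: "x \<noteq> y" using distinct_of[OF xdy] by blast
    consider "R e x y" | "R e y x"
      using completeness[of e x y] distinct_of[OF exf] distinct_of[OF y] ne by blast
    then show False
    proof cases
      case 1
      have "R e d y" by (meson 1 xdy cyclicity transitivity)
      then show False using nd y transitivity by blast
    next
      case 2
      have "R e c x" by (meson 2 yxc cyclicity transitivity)
      then show False using nc exf transitivity by blast
    qed
  qed
  then have "cyclic_interval R e f \<subseteq> cyclic_interval R c d"
    unfolding cyclic_interval_def by blast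
  with 1 2 show ?thesis by blast
qed

lemma openin_interval_topology_iff:
  "openin (interval_topology R) U \<longleftrightarrow>
     (\<forall>x\<in>U. \<exists>a b. x \<in> cyclic_interval R a b \<and> cyclic_interval R a b \<subseteq> U)"
proof
  assume "openin (interval_topology R) U"
  then have "generate_topology_on {cyclic_interval R a b | a b. True} U"
    unfolding interval_topology_def by (simp add: openin_topology_generated_by_iff)
  then show "\<forall>x\<in>U. \<exists>a b. x \<in> cyclic_interval R a b \<and> cyclic_interval R a b \<subseteq> U"
  proof induction
    case (Int A B)
    show ?case
    proof
      fix x assume x: "x \<in> A \<inter> B"
      obtain a b c d where "x \<in> cyclic_interval R a b" "cyclic_interval R a b \<subseteq> A"
          "x \<in> cyclic_interval R c d" "cyclic_interval R c d \<subseteq> B"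
        using Int x by blast
      then show "\<exists>a b. x \<in> cyclic_interval R a b \<and> cyclic_interval R a b \<subseteq> A \<inter> B"
        using interval_inter[of x a b c d] by blast
    qed
  qed blast+
next
  assume *: "\<forall>x\<in>U. \<exists>a b. x \<in> cyclic_interval R a b \<and> cyclic_interval R a b \<subseteq> U"
  have "openin (interval_topology R) (cyclic_interval R a b)" for a b
    unfolding interval_topology_def by (rule topology_generated_by_Basis) blast
  with * show "openin (interval_topology R) U"
    by (subst openin_subopen) blast
qed

lemma topspace_aut_topology: "topspace (aut_topology R) = carrier (aut_group R)"
proof -
  have "openin (interval_topology R) UNIV"
    using in_some_interval by (simp add: openin_interval_topology_iff)
  then have "topspace (interval_topology R) = UNIV"
    using openin_subset by blast
  then show ?thesis
    by (simp add: aut_topology_def aut_group_def)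
qed

end


section \<open>Bounded continuous functions and their weak topology\<close>

text \<open>Functions on the space \<open>T\<close> are represented extensionally, so that equality is equality
  on \<open>topspace T\<close>; algebraic operations are pointwise and restricted accordingly.\<close>

definition Cb :: "'g topology \<Rightarrow> ('g \<Rightarrow> complex) set" where
  "Cb T = {\<phi> \<in> extensional (topspace T).
     continuous_map T euclidean \<phi> \<and> bounded (\<phi> ` topspace T)}"

definition sup_norm :: "'g topology \<Rightarrow> ('g \<Rightarrow> complex) \<Rightarrow> real" where
  "sup_norm T \<phi> = (SUP h\<in>topspace T. norm (\<phi> h))"

definition linear_functional_on ::
    "'g set \<Rightarrow> ('g \<Rightarrow> complex) set \<Rightarrow> (('g \<Rightarrow> complex) \<Rightarrow> complex) \<Rightarrow> bool" where
  "linear_functional_on S A L \<longleftrightarrow>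
     (\<forall>\<phi>\<in>A. \<forall>\<psi>\<in>A. L (\<lambda>h\<in>S. \<phi> h + \<psi> h) = L \<phi> + L \<psi>) \<and>
     (\<forall>c. \<forall>\<phi>\<in>A. L (\<lambda>h\<in>S. c * \<phi> h) = c * L \<phi>)"

definition Cb_dual :: "'g topology \<Rightarrow> (('g \<Rightarrow> complex) \<Rightarrow> complex) set" where
  "Cb_dual T = {L \<in> extensional (Cb T). linear_functional_on (topspace T) (Cb T) L \<and>
     (\<exists>K. \<forall>\<phi>\<in>Cb T. norm (L \<phi>) \<le> K * sup_norm T \<phi>)}"

text \<open>The coarsest topology on \<open>Cb T\<close> making all bounded linear functionals continuous.\<close>

definition weak_topology :: "'g topology \<Rightarrow> ('g \<Rightarrow> complex) topology" where
  "weak_topology T =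
     pullback_topology (Cb T) (\<lambda>\<phi>. \<lambda>L\<in>Cb_dual T. L \<phi>)
       (product_topology (\<lambda>L. euclidean) (Cb_dual T))"


section \<open>Weakly almost periodic functions and the WAP compactification\<close>

definition translate :: "('g, 'b) monoid_scheme \<Rightarrow> 'g \<Rightarrow> ('g \<Rightarrow> complex) \<Rightarrow> 'g \<Rightarrow> complex" where
  "translate G g \<phi> = (\<lambda>h\<in>carrier G. \<phi> (g \<otimes>\<^bsub>G\<^esub> h))"

definition WAP :: "('g, 'b) monoid_scheme \<Rightarrow> 'g topology \<Rightarrow> ('g \<Rightarrow> complex) set" where
  "WAP G T = {\<phi> \<in> Cb T.
     compactin (weak_topology T)
       (weak_topology T closure_of ((\<lambda>g. translate G g \<phi>) ` carrier G))}"

text \<open>Characters of an algebra \<open>A\<close> of functions on \<open>S\<close>: nonzero multiplicative linear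
  functionals, with the topology of pointwise convergence on \<open>A\<close> (the weak-star topology).\<close>

definition characters ::
    "'g set \<Rightarrow> ('g \<Rightarrow> complex) set \<Rightarrow> (('g \<Rightarrow> complex) \<Rightarrow> complex) set" where
  "characters S A = {\<xi> \<in> extensional A. linear_functional_on S A \<xi> \<and>
     (\<forall>\<phi>\<in>A. \<forall>\<psi>\<in>A. \<xi> (\<lambda>h\<in>S. \<phi> h * \<psi> h) = \<xi> \<phi> * \<xi> \<psi>) \<and>
     (\<exists>\<phi>\<in>A. \<xi> \<phi> \<noteq> 0)}"

definition gelfand_space ::
    "'g set \<Rightarrow> ('g \<Rightarrow> complex) set \<Rightarrow> (('g \<Rightarrow> complex) \<Rightarrow> complex) topology" where
  "gelfand_space S A = subtopology (product_topology (\<lambda>\<phi>. euclidean) A) (characters S A)"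

definition WAP_compactification ::
    "('g, 'b) monoid_scheme \<Rightarrow> 'g topology \<Rightarrow> (('g \<Rightarrow> complex) \<Rightarrow> complex) topology" where
  "WAP_compactification G T = gelfand_space (topspace T) (WAP G T)"

end

theory Submission
  imports Defs
begin

text \<open>
  A weakly almost periodic function \<open>\<phi>\<close> on \<open>H = Aut R\<close> is shown to be constant; the Gelfand space of
  the constants is a single point.

  Weak compactness of the orbit of \<open>\<phi>\<close> enters only through Grothendieck's double limit property: the
  iterated limits of \<open>\<phi> (g\<^sub>i \<circ> h\<^sub>j)\<close> along a free ultrafilter agree
  (\<open>WAP_iterated_limits_commute\<close>). It has two consequences. Combined with continuity it makes \<open>\<phi>\<close>
  uniformly continuous on both sides (\<open>uniform_continuity_at_some_point\<close>). And if \<open>\<phi> (g\<^sub>i \<circ> h\<^sub>j)\<close>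
  is close to \<open>c\<close> for all \<open>i \<le> j\<close> and close to \<open>d\<close> for all \<open>i > j\<close>, then \<open>c\<close> is close to \<open>d\<close>
  (\<open>order_pattern_collapse\<close>).

  Fix a point \<open>p\<close>. Cutting the cyclic order at \<open>p\<close> gives a dense linear order without end points on
  the other points, written \<open>R p a b\<close> for \<open>a < b\<close>, and the stabilizer of \<open>p\<close> acts on it by order
  automorphisms that realise every increasing finite map. By uniform continuity, up to a small error
  \<open>\<phi> g\<close> depends only on how a sufficiently large finite set \<open>T\<close> and its image \<open>g T\<close> interleave
  (\<open>same_pattern_close\<close>). Let \<open>F\<close> be a small finite set that already controls \<open>\<phi>\<close> up to
  \<open>\<epsilon>\<close>, and let \<open>T \<supseteq> F\<close> control \<open>\<phi>\<close> with an error much smaller than \<open>\<epsilon> / card F\<close>. The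
  points of \<open>F\<close> cut \<open>T\<close> into blocks \<open>Q\<^sub>0 < Q\<^sub>1 < \<dots> < Q\<^sub>n\<close>. The pattern
  \<open>Q\<^sub>0 < g Q\<^sub>0 < Q\<^sub>1 < g Q\<^sub>1 < \<dots> < Q\<^sub>n < g Q\<^sub>n\<close> moves no point of \<open>F\<close> past another one, so there
  \<open>\<phi> g\<close> is close to \<open>\<phi> id\<close>. Exchanging two adjacent blocks, one of \<open>T\<close> and one of \<open>g T\<close>, hardly
  changes \<open>\<phi>\<close>: copies of the two blocks can alternate along an increasing sequence, so that
  \<open>order_pattern_collapse\<close> applies (\<open>merge_step_close\<close>). After \<open>n = card F\<close> exchanges the pattern is
  \<open>T < g T\<close>. The number of exchanges depends on \<open>F\<close> only, whereas the cost of each is governed by the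
  finer \<open>T\<close>; hence \<open>\<phi> id\<close> is the limit of \<open>\<phi> g\<close> as \<open>g\<close> in the stabilizer of \<open>p\<close> pushes larger and
  larger finite sets above themselves (\<open>value_at_identity_is_limit\<close>).

  For \<open>h\<close> in the stabilizer of \<open>p\<close>, left multiplication by \<open>h\<close> does not affect this kind of limit.
  Applied to \<open>\<phi>\<close> and to its translate by \<open>h\<close>, it gives \<open>\<phi> h = \<phi> id\<close>. As all translates of \<open>\<phi>\<close>
  have the same properties and the point stabilizers generate \<open>H\<close>, the function \<open>\<phi>\<close> is constant.
\<close>

section \<open>Free ultrafilters and iterated limits\<close>

text \<open>
  Ultrafilters are filters here, so that limits along them are ordinary \<open>tendsto\<close> limits; freeness
  is refinement of the filter of cofinite sets.
\<close>

definition free_ultrafilter :: "nat filter \<Rightarrow> bool" where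
  "free_ultrafilter U \<longleftrightarrow> U \<noteq> bot \<and> U \<le> sequentially \<and>
     (\<forall>P. eventually P U \<or> eventually (\<lambda>n. \<not> P n) U)"

text \<open>
  Zorn's lemma for the reverse order: the infimum of a chain of proper filters is proper, and a minimal
  proper filter decides every predicate, since otherwise it could be refined by that predicate.
\<close>

lemma free_ultrafilter_exists: "\<exists>U. free_ultrafilter U"
proof -
  define A :: "nat filter set" where "A = {F. F \<noteq> bot \<and> F \<le> sequentially}"
  have seqA: "sequentially \<in> A"
    by (simp add: A_def trivial_limit_sequentially)
  have "\<exists>m\<in>A. \<forall>a\<in>A. m \<ge> a \<longrightarrow> a = m"
  proof (rule predicate_Zorn)
    show "partial_order_on A (relation_of (\<lambda>a b :: nat filter. a \<ge> b) A)"
      by (rule partial_order_on_relation_ofI) auto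
  next
    fix C assume C: "C \<in> Chains (relation_of (\<lambda>a b :: nat filter. a \<ge> b) A)"
    then have CA: "C \<subseteq> A" and lin: "\<And>F G. F \<in> C \<Longrightarrow> G \<in> C \<Longrightarrow> F \<le> G \<or> G \<le> F"
      by (auto simp: Chains_def relation_of_def)
    show "\<exists>u\<in>A. \<forall>a\<in>C. a \<ge> u"
    proof (cases "C = {}")
      case True
      then show ?thesis using seqA by blast
    next
      case False
      have base: "\<exists>x\<in>C. x \<le> inf F G" if "F \<in> C" "G \<in> C" for F G
        using lin[OF that] that by (auto simp: le_inf_iff)
      have ev: "eventually P (Inf C) \<longleftrightarrow> (\<exists>b\<in>C. eventually P b)" for P
      proof (rule eventually_Inf_base)
        show "C \<noteq> {}" by fact
        show "\<exists>x\<in>C. x \<le> inf F G" if "F \<in> C" "G \<in> C" for F G by (rule base[OF that])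
      qed
      have "Inf C \<noteq> bot"
        using ev[of "\<lambda>_. False"] CA unfolding A_def trivial_limit_def by auto
      moreover obtain F where "F \<in> C" using False by blast
      then have "Inf C \<le> sequentially"
        using CA Inf_lower2[of F C sequentially] unfolding A_def by blast
      ultimately show ?thesis
        by (intro bexI[of _ "Inf C"]) (auto simp: A_def Inf_lower)
    qed
  qed
  then obtain m where m: "m \<in> A" "\<And>a. a \<in> A \<Longrightarrow> a \<le> m \<Longrightarrow> a = m" by blast
  have "eventually P m \<or> eventually (\<lambda>n. \<not> P n) m" for P
  proof (rule disjCI)
    assume "\<not> eventually (\<lambda>n. \<not> P n) m"
    then have "inf m (principal {n. P n}) \<noteq> bot"
      by (simp add: trivial_limit_def eventually_inf_principal)
    then have "inf m (principal {n. P n}) \<in> A"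
      using m(1) by (auto simp: A_def intro: le_infI1)
    then have "inf m (principal {n. P n}) = m"
      using m(2) by simp
    then have "m \<le> principal {n. P n}" by (metis inf_le2)
    then show "eventually P m" by (simp add: le_principal)
  qed
  with m(1) have "free_ultrafilter m" by (auto simp: A_def free_ultrafilter_def)
  then show ?thesis ..
qed

lemma free_ultrafilter_eventually_ge:
  assumes "free_ultrafilter U"
  shows "eventually (\<lambda>n. n \<ge> k) U" "eventually (\<lambda>n. n > k) U"
  using assms eventually_ge_at_top[of k] eventually_gt_at_top[of k]
  unfolding free_ultrafilter_def by (auto simp: filter_leD)

text \<open>
  An ultrafilter on a compact disc converges to each of its cluster points.
\<close>

lemma bounded_tendsto_ultrafilter:
  fixes f :: "nat \<Rightarrow> complex"
  assumes U: "free_ultrafilter U" and b: "\<And>n. norm (f n) \<le> M"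
  shows "\<exists>l. norm l \<le> M \<and> (f \<longlongrightarrow> l) U"
proof -
  have "filtermap f U \<noteq> bot" using U by (simp add: filtermap_bot_iff free_ultrafilter_def)
  moreover have "eventually (\<lambda>x. x \<in> cball 0 M) (filtermap f U)"
    using b by (simp add: eventually_filtermap)
  ultimately obtain l where l: "l \<in> cball 0 M" "inf (nhds l) (filtermap f U) \<noteq> bot"
    using compact_cball[of "0::complex" M] unfolding compact_filter by blast
  have "(f \<longlongrightarrow> l) U"
    unfolding tendsto_def
  proof safe
    fix S assume S: "open S" "l \<in> S"
    show "eventually (\<lambda>n. f n \<in> S) U"
    proof (rule ccontr)
      assume "\<not> ?thesis"
      then have "eventually (\<lambda>n. f n \<notin> S) U" using U unfolding free_ultrafilter_def by blast
      then have "eventually (\<lambda>x. x \<notin> S) (filtermap f U)" by (simp add: eventually_filtermap)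
      moreover have "eventually (\<lambda>x. x \<in> S) (nhds l)" using S by (simp add: eventually_nhds) blast
      ultimately have "eventually (\<lambda>x. False) (inf (nhds l) (filtermap f U))"
        unfolding eventually_inf by blast
      then show False using l(2) by (simp add: trivial_limit_def)
    qed
  qed
  with l(1) show ?thesis by auto
qed

text \<open>
  Grothendieck's double limit property of a kernel \<open>B\<close>, with the inner limits given as sequences
  \<open>a\<close> and \<open>b\<close>; for bounded \<open>B\<close> all of them exist.
\<close>

definition iterated_limits_commute :: "'x set \<Rightarrow> 'y set \<Rightarrow> ('x \<Rightarrow> 'y \<Rightarrow> complex) \<Rightarrow> bool" where
  "iterated_limits_commute X Y B \<longleftrightarrow>
     (\<forall>U x y a b c d. free_ultrafilter U \<longrightarrow> range x \<subseteq> X \<longrightarrow> range y \<subseteq> Y \<longrightarrow>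
        (\<forall>i. ((\<lambda>j. B (x i) (y j)) \<longlongrightarrow> a i) U) \<longrightarrow> (\<forall>j. ((\<lambda>i. B (x i) (y j)) \<longlongrightarrow> b j) U) \<longrightarrow>
        (a \<longlongrightarrow> c) U \<longrightarrow> (b \<longlongrightarrow> d) U \<longrightarrow> c = d)"

lemma iterated_limits_commuteD:
  assumes "iterated_limits_commute X Y B" "free_ultrafilter U"
    and "\<And>i. x i \<in> X" "\<And>j. y j \<in> Y"
    and "\<And>i. ((\<lambda>j. B (x i) (y j)) \<longlongrightarrow> a i) U" "\<And>j. ((\<lambda>i. B (x i) (y j)) \<longlongrightarrow> b j) U"
    and "(a \<longlongrightarrow> c) U" "(b \<longlongrightarrow> d) U"
  shows "c = d"
proof -
  have "range x \<subseteq> X" "range y \<subseteq> Y" using assms(3,4) by auto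
  then show ?thesis
    using assms(1)[unfolded iterated_limits_commute_def, rule_format, of U x y a b c d]
      assms(2,5-8) by blast
qed

lemma iterated_limits_commute_swap:
  assumes "iterated_limits_commute X Y B"
  shows "iterated_limits_commute Y X (\<lambda>y x. B x y)"
  unfolding iterated_limits_commute_def
proof (intro allI impI)
  fix U y x b a d c
  assume *: "free_ultrafilter U" "range y \<subseteq> Y" "range x \<subseteq> X"
    "\<forall>i. ((\<lambda>j. B (x j) (y i)) \<longlongrightarrow> b i) U" "\<forall>j. ((\<lambda>i. B (x j) (y i)) \<longlongrightarrow> a j) U"
    "(b \<longlongrightarrow> d) U" "(a \<longlongrightarrow> c) U"
  show "d = c"
    by (rule iterated_limits_commuteD[OF assms *(1) _ _ _ _ *(7,6), of x y, symmetric]) (use * in auto)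
qed

lemma obtain_iterated_limits:
  assumes comm: "iterated_limits_commute X Y B"
    and bdd: "\<And>x y. x \<in> X \<Longrightarrow> y \<in> Y \<Longrightarrow> norm (B x y) \<le> M"
    and U: "free_ultrafilter U" and x: "\<And>i::nat. x i \<in> X" and y: "\<And>j::nat. y j \<in> Y"
  obtains a b c where "\<And>i. ((\<lambda>j. B (x i) (y j)) \<longlongrightarrow> a i) U"
    "\<And>j. ((\<lambda>i. B (x i) (y j)) \<longlongrightarrow> b j) U" "(a \<longlongrightarrow> c) U" "(b \<longlongrightarrow> c) U"
proof -
  have "\<exists>l. norm l \<le> M \<and> ((\<lambda>j. B (x i) (y j)) \<longlongrightarrow> l) U" for i
    by (rule bounded_tendsto_ultrafilter[OF U]) (simp add: bdd x y)
  then obtain a where a: "\<And>i. norm (a i) \<le> M" "\<And>i. ((\<lambda>j. B (x i) (y j)) \<longlongrightarrow> a i) U"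
    by metis
  have "\<exists>l. norm l \<le> M \<and> ((\<lambda>i. B (x i) (y j)) \<longlongrightarrow> l) U" for j
    by (rule bounded_tendsto_ultrafilter[OF U]) (simp add: bdd x y)
  then obtain b where b: "\<And>i. norm (b i) \<le> M" "\<And>j. ((\<lambda>i. B (x i) (y j)) \<longlongrightarrow> b j) U"
    by metis
  obtain c where c: "(a \<longlongrightarrow> c) U" using bounded_tendsto_ultrafilter[where f=a, OF U a(1)] by blast
  obtain d where d: "(b \<longlongrightarrow> d) U" using bounded_tendsto_ultrafilter[where f=b, OF U b(1)] by blast
  have "c = d" by (rule iterated_limits_commuteD[OF comm U x y a(2) b(2) c d])
  with a(2) b(2) c d that show ?thesis by blast
qed

text \<open>
  The row limits all lie in the disc around \<open>c\<close> and the column limits all lie in the disc around \<open>d\<close>,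
  so the common iterated limit lies in both. This is the source of every estimate that compares
  different interleavings below.
\<close>

lemma order_pattern_collapse:
  assumes comm: "iterated_limits_commute X Y B"
    and bdd: "\<And>x y. x \<in> X \<Longrightarrow> y \<in> Y \<Longrightarrow> norm (B x y) \<le> M"
    and x: "\<And>i::nat. x i \<in> X" and y: "\<And>j::nat. y j \<in> Y"
    and upper: "\<And>i j. i \<le> j \<Longrightarrow> norm (B (x i) (y j) - c) \<le> r"
    and lower: "\<And>i j. j < i \<Longrightarrow> norm (B (x i) (y j) - d) \<le> r"
  shows "norm (c - d) \<le> 2 * r"
proof -
  obtain U where U: "free_ultrafilter U" using free_ultrafilter_exists ..
  then have nb: "U \<noteq> bot" by (simp add: free_ultrafilter_def)
  obtain a b l where a: "\<And>i. ((\<lambda>j. B (x i) (y j)) \<longlongrightarrow> a i) U"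
    and b: "\<And>j. ((\<lambda>i. B (x i) (y j)) \<longlongrightarrow> b j) U" and l: "(a \<longlongrightarrow> l) U" "(b \<longlongrightarrow> l) U"
    using obtain_iterated_limits[where B=B and x=x and y=y, OF comm bdd U x y] by blast
  have "norm (a i - c) \<le> r" for i
    by (rule tendsto_upperbound[OF tendsto_norm[OF tendsto_diff[OF a tendsto_const]] _ nb])
       (rule eventually_mono[OF free_ultrafilter_eventually_ge(1)[OF U, of i]], rule upper)
  then have 1: "norm (l - c) \<le> r"
    by (intro tendsto_upperbound[OF tendsto_norm[OF tendsto_diff[OF l(1) tendsto_const]] _ nb]) simp
  have "norm (b j - d) \<le> r" for j
    by (rule tendsto_upperbound[OF tendsto_norm[OF tendsto_diff[OF b tendsto_const]] _ nb])
       (rule eventually_mono[OF free_ultrafilter_eventually_ge(2)[OF U, of j]], rule lower)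
  then have 2: "norm (l - d) \<le> r"
    by (intro tendsto_upperbound[OF tendsto_norm[OF tendsto_diff[OF l(2) tendsto_const]] _ nb]) simp
  have "norm (c - d) \<le> norm (l - d) + norm (l - c)"
    using norm_triangle_ineq4[of "l - d" "l - c"] by simp
  then show ?thesis using 1 2 by simp
qed

section \<open>Uniform continuity from commuting iterated limits\<close>

text \<open>
  Total boundedness of the set of vectors \<open>(B a y)\<^sub>a\<close>: a grid of mesh \<open>\<delta> / 2\<close> in the real
  and in the imaginary direction has finitely many cells that meet the disc of radius \<open>M\<close>.
\<close>

lemma finite_net_of_bounded_family:
  fixes B :: "'x \<Rightarrow> 'y \<Rightarrow> complex"
  assumes "finite A" "\<And>a y. a \<in> A \<Longrightarrow> y \<in> Y \<Longrightarrow> norm (B a y) \<le> M" "\<delta> > 0"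
  shows "\<exists>Z. finite Z \<and> Z \<subseteq> Y \<and> (\<forall>y\<in>Y. \<exists>z\<in>Z. \<forall>a\<in>A. norm (B a y - B a z) \<le> \<delta>)"
proof -
  define q where "q c = (\<lfloor>Re c * 2 / \<delta>\<rfloor>, \<lfloor>Im c * 2 / \<delta>\<rfloor>)" for c
  define K where "K = \<lceil>M * 2 / \<delta>\<rceil>"
  have qK: "q c \<in> {-K-1..K} \<times> {-K-1..K}" if "norm c \<le> M" for c
  proof -
    have *: "\<lfloor>t * 2 / \<delta>\<rfloor> \<in> {-K-1..K}" if t: "\<bar>t\<bar> \<le> M" for t
    proof -
      have "\<bar>t * 2 / \<delta>\<bar> \<le> M * 2 / \<delta>"
        using t assms(3) by (simp add: abs_mult divide_right_mono)
      then have "\<bar>t * 2 / \<delta>\<bar> \<le> of_int K" unfolding K_def by linarith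
      then have "- of_int K \<le> t * 2 / \<delta>" "t * 2 / \<delta> \<le> of_int K" by linarith+
      then have "- K - 1 \<le> \<lfloor>t * 2 / \<delta>\<rfloor>" "\<lfloor>t * 2 / \<delta>\<rfloor> \<le> K" by linarith+
      then show ?thesis by simp
    qed
    show ?thesis unfolding q_def
      using *[of "Re c"] *[of "Im c"] abs_Re_le_cmod[of c] abs_Im_le_cmod[of c] that by auto
  qed
  define f where "f y = restrict (\<lambda>a. q (B a y)) A" for y
  have "f ` Y \<subseteq> PiE A (\<lambda>_. {-K-1..K} \<times> {-K-1..K})"
  proof (rule image_subsetI)
    fix y assume "y \<in> Y"
    then show "f y \<in> PiE A (\<lambda>_. {-K-1..K} \<times> {-K-1..K})"
      using qK assms(2) unfolding f_def by (simp only: restrict_PiE_iff) blast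
  qed
  moreover have "finite (PiE A (\<lambda>_. {-K-1..K} \<times> {-K-1..K}))"
    by (rule finite_PiE) (auto simp: assms(1))
  ultimately have "finite (f ` Y)" by (rule finite_subset)
  then obtain Z where Z: "Z \<subseteq> Y" "finite Z" "f ` Y = f ` Z"
    using finite_subset_image[of "f ` Y" f Y] by blast
  have close: "norm (c - d) \<le> \<delta>" if "q c = q d" for c d
  proof -
    have *: "\<bar>s - t\<bar> \<le> \<delta> / 2" if "\<lfloor>s * 2 / \<delta>\<rfloor> = \<lfloor>t * 2 / \<delta>\<rfloor>" for s t
    proof -
      have "s * 2 / \<delta> - t * 2 / \<delta> \<le> 1" "t * 2 / \<delta> - s * 2 / \<delta> \<le> 1"
        using that by linarith+
      then have "s * 2 - t * 2 \<le> \<delta>" "t * 2 - s * 2 \<le> \<delta>"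
        using assms(3) by (simp_all add: diff_divide_distrib[symmetric])
      then show ?thesis by linarith
    qed
    show ?thesis
      using cmod_le[of "c - d"] *[of "Re c" "Re d"] *[of "Im c" "Im d"] that
      unfolding q_def by simp
  qed
  have "\<exists>z\<in>Z. \<forall>a\<in>A. norm (B a y - B a z) \<le> \<delta>" if "y \<in> Y" for y
  proof -
    have "f y \<in> f ` Z" unfolding Z(3)[symmetric] using that by (rule imageI)
    then obtain z where z: "z \<in> Z" "f y = f z" by (rule imageE)
    have "q (B a y) = q (B a z)" if "a \<in> A" for a
      using fun_cong[OF z(2), of a] that by (simp add: f_def)
    then show ?thesis using close z(1) by blast
  qed
  with Z show ?thesis by blast
qed

text \<open>
  A form of Namioka's theorem. If uniformity fails everywhere, one can walk \<open>x\<^sub>0, x\<^sub>1, \<dots>\<close> by small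
  moves \<open>act v\<close> and choose pairs \<open>y\<^sub>n, y'\<^sub>n\<close> that \<open>B\<close> hardly separates at the earlier points
  \<open>x\<^sub>m\<close> with \<open>m < n\<close> but separates by \<open>\<eta>\<close> at \<open>x\<^sub>n\<close>. Separation by \<open>\<eta>\<close> is an open condition, so
  the moves can be taken so small that it persists at all later points. Then the iterated limits of
  \<open>B (x\<^sub>m) (y\<^sub>n) - B (x\<^sub>m) (y'\<^sub>n)\<close> are \<open>0\<close> in one order and at least \<open>\<eta>\<close> in absolute value in
  the other. When \<open>act\<close> is a translation of a group, uniformity at one point is uniformity everywhere.
\<close>

lemma uniform_continuity_at_some_point:
  fixes B :: "'x \<Rightarrow> 'y \<Rightarrow> complex" and act :: "'v \<Rightarrow> 'x \<Rightarrow> 'x"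
  assumes comm: "iterated_limits_commute X Y B"
    and bdd: "\<And>x y. x \<in> X \<Longrightarrow> y \<in> Y \<Longrightarrow> norm (B x y) \<le> M"
    and x0: "x0 \<in> X"
    and act: "eventually (\<lambda>v. \<forall>x\<in>X. act v x \<in> X) N"
    and cont: "\<And>x y. x \<in> X \<Longrightarrow> y \<in> Y \<Longrightarrow> ((\<lambda>v. B (act v x) y) \<longlongrightarrow> B x y) N"
    and "\<epsilon> > 0"
  shows "\<exists>x\<in>X. eventually (\<lambda>v. \<forall>y\<in>Y. norm (B (act v x) y - B x y) < \<epsilon>) N"
proof (rule ccontr)
  assume "\<not> ?thesis"
  then have not_unif: "\<not> eventually (\<lambda>v. \<forall>y\<in>Y. norm (B (act v x) y - B x y) < \<epsilon>) N"
    if "x \<in> X" for x using that by blast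
  \<comment> \<open>The error of a small move is a sum of three terms, each at most \<open>\<eta>\<close>.\<close>
  define \<eta> where "\<eta> = \<epsilon> / 4"
  have "\<eta> > 0" using assms by (simp add: \<eta>_def)
  \<comment> \<open>If no such move existed, a finite net of \<open>y\<close>s would make the kernel uniformly continuous at \<open>x\<close>.\<close>
  have step: "\<exists>x'\<in>X. P x' \<and> (\<exists>y\<in>Y. \<exists>y'\<in>Y.
      (\<forall>a\<in>A. norm (B a y - B a y') \<le> \<delta>) \<and> norm (B x' y - B x' y') > \<eta>)"
    if x: "x \<in> X" and Px: "P x" and P: "eventually (\<lambda>v. P (act v x)) N"
      and A: "finite A" "A \<subseteq> X" and "\<delta> > 0" for x P A \<delta>
  proof (rule ccontr)
    assume no: "\<not> ?thesis"
    have no': "norm (B x' y - B x' y') \<le> \<eta>"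
      if "x' \<in> X" "P x'" "y \<in> Y" "y' \<in> Y" "\<forall>a\<in>A. norm (B a y - B a y') \<le> \<delta>" for x' y y'
      using no that by (simp only: not_le[symmetric]) blast
    have "\<exists>Z. finite Z \<and> Z \<subseteq> Y \<and> (\<forall>y\<in>Y. \<exists>z\<in>Z. \<forall>a\<in>A. norm (B a y - B a z) \<le> \<delta>)"
      by (rule finite_net_of_bounded_family[where M=M]) (use A bdd \<open>\<delta> > 0\<close> in auto)
    then obtain Z where Z: "finite Z" "Z \<subseteq> Y" "\<forall>y\<in>Y. \<exists>z\<in>Z. \<forall>a\<in>A. norm (B a y - B a z) \<le> \<delta>"
      by (elim exE conjE)
    have "eventually (\<lambda>v. \<forall>z\<in>Z. norm (B (act v x) z - B x z) < \<eta>) N"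
    proof (rule eventually_ball_finite[OF Z(1)])
      show "\<forall>z\<in>Z. \<forall>\<^sub>F v in N. cmod (B (act v x) z - B x z) < \<eta>"
        using cont[OF x] Z(2) \<open>\<eta> > 0\<close> by (auto simp: tendsto_iff dist_norm)
    qed
    with P act have "eventually (\<lambda>v. \<forall>y\<in>Y. norm (B (act v x) y - B x y) < \<epsilon>) N"
    proof eventually_elim
      case (elim v)
      show ?case
      proof
        fix y assume y: "y \<in> Y"
        then obtain z where z: "z \<in> Z" "\<forall>a\<in>A. norm (B a y - B a z) \<le> \<delta>" using Z(3) by blast
        have av: "act v x \<in> X" using elim(2) x by blast
        have 1: "norm (B (act v x) y - B (act v x) z) \<le> \<eta>"
          using z Z(2) by (intro no' av elim(1) y) auto
        have 2: "norm (B x y - B x z) \<le> \<eta>"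
          using z Z(2) by (intro no' x Px y) auto
        have 3: "norm (B (act v x) z - B x z) < \<eta>" using elim(3) z by blast
        have "B (act v x) y - B x y =
            (B (act v x) y - B (act v x) z) + (B (act v x) z - B x z) - (B x y - B x z)" by simp
        then have "norm (B (act v x) y - B x y) \<le>
            norm (B (act v x) y - B (act v x) z) + norm (B (act v x) z - B x z) + norm (B x y - B x z)"
          by (metis norm_triangle_ineq norm_triangle_ineq4 add_right_mono order_trans)
        then show "norm (B (act v x) y - B x y) < \<epsilon>"
          using 1 2 3 \<open>\<eta> > 0\<close> unfolding \<eta>_def by linarith
      qed
    qed
    then show False using not_unif x by blast
  qed
  \<comment> \<open>The entry \<open>r = (x, y, y')\<close> is admissible at time \<open>n\<close> after the history \<open>f\<close>.\<close>
  define Q where "Q f n r \<longleftrightarrow>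
      fst r \<in> X \<and> fst (snd r) \<in> Y \<and> snd (snd r) \<in> Y \<and>
      (\<forall>m<n. norm (B (fst (f m)) (fst (snd r)) - B (fst (f m)) (snd (snd r))) \<le> 1 / Suc n) \<and>
      (\<forall>m<n. norm (B (fst r) (fst (snd (f m))) - B (fst r) (snd (snd (f m)))) > \<eta>) \<and>
      norm (B (fst r) (fst (snd r)) - B (fst r) (snd (snd r))) > \<eta>"
    for f :: "nat \<Rightarrow> 'x \<times> 'y \<times> 'y" and n :: nat and r
  have "\<exists>f. \<forall>n. Q f n (f n)"
  proof (rule dependent_wellorder_choice)
    show "Q f n r = Q g n r" if "\<And>m. m < n \<Longrightarrow> f m = g m" for r f g n
      unfolding Q_def using that by simp
  next
    fix n and f :: "nat \<Rightarrow> 'x \<times> 'y \<times> 'y"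
    assume hist: "\<And>m. m < n \<Longrightarrow> Q f m (f m)"
    \<comment> \<open>The walk continues from the last point of the history.\<close>
    define x where "x = (if n = 0 then x0 else fst (f (n - 1)))"
    define P where "P x' \<longleftrightarrow> (\<forall>m\<in>{..<n}. norm (B x' (fst (snd (f m))) - B x' (snd (snd (f m)))) > \<eta>)" for x'
    have histX: "fst (f m) \<in> X" and histY: "fst (snd (f m)) \<in> Y" "snd (snd (f m)) \<in> Y" if "m < n" for m
      using hist[OF that] unfolding Q_def by auto
    have x: "x \<in> X" using x0 histX unfolding x_def by auto
    have Px: "P x"
      unfolding P_def
    proof
      fix m assume "m \<in> {..<n}"
      then have m: "m < n" by simp
      then have n: "n > 0" by simp
      have "Q f (n - 1) (f (n - 1))" using hist n by simp
      then show "norm (B x (fst (snd (f m))) - B x (snd (snd (f m)))) > \<eta>"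
        using m n unfolding Q_def x_def
        by (cases "m = n - 1") auto
    qed
    have "eventually (\<lambda>v. P (act v x)) N"
      unfolding P_def
    proof (rule eventually_ball_finite, simp, rule ballI)
      fix m assume "m \<in> {..<n}"
      then have m: "m < n" by simp
      have "((\<lambda>v. norm (B (act v x) (fst (snd (f m))) - B (act v x) (snd (snd (f m))))) \<longlongrightarrow>
          norm (B x (fst (snd (f m))) - B x (snd (snd (f m))))) N"
        by (intro tendsto_norm tendsto_diff cont x histY m)
      moreover have "\<eta> < norm (B x (fst (snd (f m))) - B x (snd (snd (f m))))"
        using Px m unfolding P_def by simp
      ultimately show "\<forall>\<^sub>F v in N. \<eta> < norm (B (act v x) (fst (snd (f m))) - B (act v x) (snd (snd (f m))))"
        by (rule order_tendstoD(1))
    qed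
    from step[OF x Px this, of "(\<lambda>m. fst (f m)) ` {..<n}" "1 / Suc n"]
    obtain x' y y' where "x' \<in> X" "P x'" "y \<in> Y" "y' \<in> Y"
      "\<forall>a\<in>(\<lambda>m. fst (f m)) ` {..<n}. norm (B a y - B a y') \<le> 1 / Suc n" "norm (B x' y - B x' y') > \<eta>"
      using histX by auto
    then have "Q f n (x', y, y')" unfolding Q_def P_def by auto
    then show "\<exists>r. Q f n r" ..
  qed
  then obtain f where f: "\<And>n. Q f n (f n)" by blast
  define x where "x n = fst (f n)" for n
  define y where "y n = fst (snd (f n))" for n
  define y' where "y' n = snd (snd (f n))" for n
  have X: "x n \<in> X" and Y: "y n \<in> Y" "y' n \<in> Y" for n
    using f[of n] unfolding Q_def x_def y_def y'_def by auto
  have near: "norm (B (x m) (y n) - B (x m) (y' n)) \<le> 1 / Suc n" if "m < n" for m n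
    using f[of n] that unfolding Q_def x_def y_def y'_def by auto
  have far: "norm (B (x m) (y n) - B (x m) (y' n)) \<ge> \<eta>" if "n \<le> m" for m n
    using f[of m] that unfolding Q_def x_def y_def y'_def
    by (cases "m = n") (simp_all add: less_imp_le)
  obtain U where U: "free_ultrafilter U" using free_ultrafilter_exists ..
  then have nb: "U \<noteq> bot" by (simp add: free_ultrafilter_def)
  obtain a b l where a: "\<And>i. ((\<lambda>j. B (x i) (y j)) \<longlongrightarrow> a i) U"
    and b: "\<And>j. ((\<lambda>i. B (x i) (y j)) \<longlongrightarrow> b j) U" and l: "(a \<longlongrightarrow> l) U" "(b \<longlongrightarrow> l) U"
    using obtain_iterated_limits[where B=B and x=x and y=y, OF comm bdd U X Y(1)] by blast
  obtain a' b' l' where a': "\<And>i. ((\<lambda>j. B (x i) (y' j)) \<longlongrightarrow> a' i) U"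
    and b': "\<And>j. ((\<lambda>i. B (x i) (y' j)) \<longlongrightarrow> b' j) U" and l': "(a' \<longlongrightarrow> l') U" "(b' \<longlongrightarrow> l') U"
    using obtain_iterated_limits[where B=B and x=x and y=y', OF comm bdd U X Y(2)] by blast
  have "norm (b j - b' j) \<ge> \<eta>" for j
    by (rule tendsto_lowerbound[OF tendsto_norm[OF tendsto_diff[OF b b']] _ nb])
       (rule eventually_mono[OF free_ultrafilter_eventually_ge(1)[OF U, of j]], rule far)
  then have "norm (l - l') \<ge> \<eta>"
    by (intro tendsto_lowerbound[OF tendsto_norm[OF tendsto_diff[OF l(2) l'(2)]] _ nb]) simp
  moreover have "a i - a' i = 0" for i
  proof -
    have "(\<lambda>n. 1 / real (Suc n)) \<longlonglongrightarrow> 0" by (rule LIMSEQ_Suc) (rule lim_1_over_n)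
    then have "((\<lambda>n. 1 / real (Suc n)) \<longlongrightarrow> 0) U"
      using U unfolding free_ultrafilter_def by (meson filterlim_mono order_refl)
    then have "((\<lambda>n. B (x i) (y n) - B (x i) (y' n)) \<longlongrightarrow> 0) U"
      by (rule Lim_null_comparison[rotated])
         (rule eventually_mono[OF free_ultrafilter_eventually_ge(2)[OF U, of i]], rule near)
    then show ?thesis using tendsto_diff[OF a a'] tendsto_unique[OF nb] by blast
  qed
  then have "l - l' = 0"
    using tendsto_diff[OF l(1) l'(1)] tendsto_unique[OF nb] by (simp add: tendsto_const_iff nb)
  ultimately show False using \<open>\<eta> > 0\<close> by simp
qed

section \<open>Iterated limits of weakly almost periodic functions\<close>

lemma Cb_add:
  assumes "\<phi> \<in> Cb T" "\<psi> \<in> Cb T"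
  shows "(\<lambda>h\<in>topspace T. \<phi> h + \<psi> h) \<in> Cb T"
proof -
  have "continuous_map T euclidean (\<lambda>h. \<phi> h + \<psi> h)"
    using assms unfolding Cb_def by (intro continuous_map_add) auto
  then have "continuous_map T euclidean (\<lambda>h\<in>topspace T. \<phi> h + \<psi> h)"
    by (rule continuous_map_eq) simp
  moreover have "bounded ((\<lambda>h. \<phi> h + \<psi> h) ` topspace T)"
    using assms unfolding Cb_def by (intro bounded_plus_comp) auto
  ultimately show ?thesis by (simp add: Cb_def)
qed

lemma Cb_scale:
  assumes "\<phi> \<in> Cb T"
  shows "(\<lambda>h\<in>topspace T. c * \<phi> h) \<in> Cb T"
proof -
  have "continuous_map T euclidean ((\<lambda>z. c * z) \<circ> \<phi>)"
    by (rule continuous_map_compose[where X'=euclidean])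
       (use assms in \<open>auto simp: Cb_def intro!: continuous_intros\<close>)
  then have "continuous_map T euclidean (\<lambda>h\<in>topspace T. c * \<phi> h)"
    by (rule continuous_map_eq) simp
  moreover obtain M where M: "\<And>h. h \<in> topspace T \<Longrightarrow> norm (\<phi> h) \<le> M"
    using assms unfolding Cb_def bounded_iff by auto
  have "bounded ((\<lambda>h. c * \<phi> h) ` topspace T)"
    unfolding bounded_iff using M
    by (intro exI[of _ "norm c * M"]) (auto simp: norm_mult intro!: mult_left_mono)
  ultimately show ?thesis by (simp add: Cb_def)
qed

lemma Cb_const: "(\<lambda>h\<in>topspace T. c) \<in> Cb T"
proof -
  have "continuous_map T euclidean (\<lambda>h\<in>topspace T. c)"
    by (rule continuous_map_eq[of _ _ "\<lambda>_. c"]) auto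
  then show ?thesis by (auto simp: Cb_def bounded_iff)
qed

lemma norm_le_sup_norm:
  assumes "\<phi> \<in> Cb T" "h \<in> topspace T"
  shows "norm (\<phi> h) \<le> sup_norm T \<phi>"
  unfolding sup_norm_def
proof (rule cSUP_upper[OF assms(2)])
  show "bdd_above ((\<lambda>h. norm (\<phi> h)) ` topspace T)"
    using assms(1) unfolding Cb_def bounded_iff bdd_above_def by auto
qed

text \<open>
  The limit along an ultrafilter of point evaluations is a functional of norm at most one. For a
  constant sequence \<open>h\<close> it is the evaluation itself.
\<close>

lemma ultrafilter_limit_in_Cb_dual:
  assumes U: "free_ultrafilter U" and h: "\<And>j. h j \<in> topspace T"
  shows "\<exists>L\<in>Cb_dual T. \<forall>\<psi>\<in>Cb T. ((\<lambda>j. \<psi> (h j)) \<longlongrightarrow> L \<psi>) U"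
proof -
  have nb: "U \<noteq> bot" using U by (simp add: free_ultrafilter_def)
  have ex: "\<exists>l. norm l \<le> sup_norm T \<psi> \<and> ((\<lambda>j. \<psi> (h j)) \<longlongrightarrow> l) U" if "\<psi> \<in> Cb T" for \<psi>
    by (rule bounded_tendsto_ultrafilter[OF U]) (rule norm_le_sup_norm[OF that h])
  define L where "L = (\<lambda>\<psi>\<in>Cb T. Lim U (\<lambda>j. \<psi> (h j)))"
  have L: "norm (L \<psi>) \<le> sup_norm T \<psi>" "((\<lambda>j. \<psi> (h j)) \<longlongrightarrow> L \<psi>) U" if psi: "\<psi> \<in> Cb T" for \<psi>
  proof -
    obtain l where l: "norm l \<le> sup_norm T \<psi>" "((\<lambda>j. \<psi> (h j)) \<longlongrightarrow> l) U" using ex[OF psi] by blast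
    then have "L \<psi> = l" using tendsto_Lim[OF nb l(2)] psi by (simp add: L_def)
    with l show "norm (L \<psi>) \<le> sup_norm T \<psi>" "((\<lambda>j. \<psi> (h j)) \<longlongrightarrow> L \<psi>) U" by auto
  qed
  have "L (\<lambda>h\<in>topspace T. \<phi> h + \<psi> h) = L \<phi> + L \<psi>" if "\<phi> \<in> Cb T" "\<psi> \<in> Cb T" for \<phi> \<psi>
    using tendsto_unique[OF nb L(2)[OF Cb_add[OF that]]] tendsto_add[OF L(2)[OF that(1)] L(2)[OF that(2)]] h
    by simp
  moreover have "L (\<lambda>h\<in>topspace T. c * \<phi> h) = c * L \<phi>" if "\<phi> \<in> Cb T" for c \<phi>
    using tendsto_unique[OF nb L(2)[OF Cb_scale[OF that]]] tendsto_mult[OF tendsto_const L(2)[OF that]] h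
    by simp
  ultimately have "linear_functional_on (topspace T) (Cb T) L"
    by (simp add: linear_functional_on_def)
  moreover have "\<exists>K. \<forall>\<phi>\<in>Cb T. norm (L \<phi>) \<le> K * sup_norm T \<phi>"
    using L(1) by (intro exI[of _ 1]) simp
  ultimately have "L \<in> Cb_dual T" by (simp add: Cb_dual_def L_def)
  then show ?thesis using L(2) by (intro bexI[of _ L]) simp_all
qed

lemma topspace_weak_topology: "topspace (weak_topology T) = Cb T"
  by (auto simp: weak_topology_def topspace_pullback_topology)

lemma continuous_map_weak_topology:
  assumes "L \<in> Cb_dual T"
  shows "continuous_map (weak_topology T) euclidean L"
proof -
  have "continuous_map (weak_topology T) euclidean ((\<lambda>x. x L) \<circ> (\<lambda>\<phi>. \<lambda>L\<in>Cb_dual T. L \<phi>))"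
    unfolding weak_topology_def
    by (rule continuous_map_pullback) (rule continuous_map_product_projection[OF assms])
  then show ?thesis by (rule continuous_map_eq) (simp add: assms)
qed

lemma compactin_ultrafilter_cluster:
  assumes K: "compactin T K" and U: "free_ultrafilter U" and x: "\<And>i. x i \<in> K"
  shows "\<exists>k\<in>K. \<forall>W. openin T W \<longrightarrow> k \<in> W \<longrightarrow> eventually (\<lambda>i. x i \<in> W) U"
proof (rule ccontr)
  assume no: "\<not> ?thesis"
  define \<W> where "\<W> = {W. openin T W \<and> eventually (\<lambda>i. x i \<notin> W) U}"
  have "K \<subseteq> \<Union>\<W>"
    using no U unfolding \<W>_def free_ultrafilter_def by blast
  moreover have "\<forall>W\<in>\<W>. openin T W" by (simp add: \<W>_def)
  ultimately obtain \<F> where \<F>: "finite \<F>" "\<F> \<subseteq> \<W>" "K \<subseteq> \<Union>\<F>"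
    using K unfolding compactin_def by meson
  have "eventually (\<lambda>i. \<forall>W\<in>\<F>. x i \<notin> W) U"
    by (rule eventually_ball_finite[OF \<F>(1)]) (use \<F>(2) in \<open>auto simp: \<W>_def\<close>)
  moreover have "\<not> (\<forall>W\<in>\<F>. x i \<notin> W)" for i
    using \<F>(3) x[of i] by blast
  ultimately have "eventually (\<lambda>i. False) U" by simp
  then show False using U by (simp add: free_ultrafilter_def trivial_limit_def)
qed

text \<open>
  Let \<open>f\<close> be the weak limit of the translates of \<open>\<phi>\<close> by \<open>g\<^sub>i\<close> along the ultrafilter, and let \<open>L\<close>
  be the limit of the evaluations at \<open>h\<^sub>j\<close>. Both iterated limits equal \<open>L f\<close>: one because \<open>L\<close> is
  weakly continuous, the other because evaluations are.
\<close>

lemma WAP_iterated_limits_commute: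
  assumes \<phi>: "\<phi> \<in> WAP G T" and T: "topspace T = carrier G"
    and trans: "\<And>g. g \<in> carrier G \<Longrightarrow> translate G g \<phi> \<in> Cb T"
  shows "iterated_limits_commute (carrier G) (carrier G) (\<lambda>g h. \<phi> (g \<otimes>\<^bsub>G\<^esub> h))"
  unfolding iterated_limits_commute_def
proof (intro allI impI)
  fix U g h a b c d
  assume U: "free_ultrafilter U" and "range g \<subseteq> carrier G" "range h \<subseteq> carrier G"
    and a: "\<forall>i. ((\<lambda>j. \<phi> (g i \<otimes>\<^bsub>G\<^esub> h j)) \<longlongrightarrow> a i) U"
    and b: "\<forall>j. ((\<lambda>i. \<phi> (g i \<otimes>\<^bsub>G\<^esub> h j)) \<longlongrightarrow> b j) U"
    and c: "(a \<longlongrightarrow> c) U" and d: "(b \<longlongrightarrow> d) U"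
  then have g: "\<And>i. g i \<in> carrier G" and h: "\<And>j. h j \<in> topspace T" by (auto simp: T)
  have nb: "U \<noteq> bot" using U by (simp add: free_ultrafilter_def)
  define K where "K = weak_topology T closure_of ((\<lambda>g. translate G g \<phi>) ` carrier G)"
  have K: "compactin (weak_topology T) K" using \<phi> by (simp add: WAP_def K_def)
  have orbit: "translate G (g i) \<phi> \<in> K" for i
    using closure_of_subset[of "(\<lambda>g. translate G g \<phi>) ` carrier G" "weak_topology T"] trans g
    by (auto simp: K_def topspace_weak_topology)
  obtain f where fK: "f \<in> K" and
    f: "\<And>W. openin (weak_topology T) W \<Longrightarrow> f \<in> W \<Longrightarrow> eventually (\<lambda>i. translate G (g i) \<phi> \<in> W) U"
    using compactin_ultrafilter_cluster[OF K U, of "\<lambda>i. translate G (g i) \<phi>"] orbit by blast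
  have fCb: "f \<in> Cb T" using fK K by (auto simp: compactin_def topspace_weak_topology)
  have lim: "((\<lambda>i. L (translate G (g i) \<phi>)) \<longlongrightarrow> L f) U" if L: "L \<in> Cb_dual T" for L
    unfolding tendsto_def
  proof safe
    fix S assume S: "open S" "L f \<in> S"
    have "openin (weak_topology T) {\<psi> \<in> Cb T. L \<psi> \<in> S}"
      using openin_continuous_map_preimage[OF continuous_map_weak_topology[OF L], of S] S
      by (simp add: topspace_weak_topology)
    from f[OF this] show "eventually (\<lambda>i. L (translate G (g i) \<phi>) \<in> S) U"
      using S fCb by (auto elim: eventually_mono)
  qed
  obtain L where L: "L \<in> Cb_dual T" and Lim: "\<forall>\<psi>\<in>Cb T. ((\<lambda>j. \<psi> (h j)) \<longlongrightarrow> L \<psi>) U"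
    using ultrafilter_limit_in_Cb_dual[where h=h, OF U h] by (rule bexE)
  have "L (translate G (g i) \<phi>) = a i" for i
    using tendsto_unique[OF nb Lim[rule_format, OF trans[OF g]]] a h unfolding translate_def T by simp
  then have "L f = c" using lim[OF L] c tendsto_unique[OF nb] by simp
  have "f (h j) = b j" for j
  proof -
    obtain E where E: "E \<in> Cb_dual T" and ELim: "\<forall>\<psi>\<in>Cb T. ((\<lambda>_. \<psi> (h j)) \<longlongrightarrow> E \<psi>) U"
      using ultrafilter_limit_in_Cb_dual[where h="\<lambda>_. h j", OF U h] by (rule bexE)
    have ev: "E \<psi> = \<psi> (h j)" if "\<psi> \<in> Cb T" for \<psi>
      using ELim[rule_format, OF that] by (simp add: tendsto_const_iff nb)
    have "((\<lambda>i. \<phi> (g i \<otimes>\<^bsub>G\<^esub> h j)) \<longlongrightarrow> f (h j)) U"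
      using lim[OF E] ev trans g h fCb unfolding T by (simp add: translate_def)
    then show ?thesis using b tendsto_unique[OF nb] by blast
  qed
  then have "L f = d" using Lim[rule_format, OF fCb] d tendsto_unique[OF nb] by simp
  with \<open>L f = c\<close> show "c = d" by simp
qed

section \<open>Constant functions and their characters\<close>

text \<open>
  The orbit is a single point, and it is closed because evaluations are weakly continuous and separate
  points.
\<close>

lemma constants_in_WAP:
  assumes T: "topspace T = carrier G"
    and closed: "\<And>g h. g \<in> carrier G \<Longrightarrow> h \<in> carrier G \<Longrightarrow> g \<otimes>\<^bsub>G\<^esub> h \<in> carrier G"
  shows "(\<lambda>h\<in>topspace T. c) \<in> WAP G T"
proof -
  define \<phi> :: "_ \<Rightarrow> complex" where "\<phi> = (\<lambda>h\<in>topspace T. c)"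
  have \<phi>: "\<phi> \<in> Cb T" unfolding \<phi>_def by (rule Cb_const)
  have "translate G g \<phi> = \<phi>" if "g \<in> carrier G" for g
    unfolding translate_def \<phi>_def T using closed[OF that] by auto
  then have sub: "(\<lambda>g. translate G g \<phi>) ` carrier G \<subseteq> {\<phi>}" by auto
  have "weak_topology T closure_of {\<phi>} \<subseteq> {\<phi>}"
  proof
    fix \<psi> assume cl: "\<psi> \<in> weak_topology T closure_of {\<phi>}"
    then have \<psi>: "\<psi> \<in> Cb T" by (simp add: in_closure_of topspace_weak_topology)
    obtain U where U: "free_ultrafilter U" using free_ultrafilter_exists ..
    then have nb: "U \<noteq> bot" by (simp add: free_ultrafilter_def)
    have "\<psi> h = \<phi> h" if h: "h \<in> topspace T" for h
    proof (rule ccontr)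
      assume ne: "\<psi> h \<noteq> \<phi> h"
      obtain E where E: "E \<in> Cb_dual T" and ELim: "\<forall>\<psi>\<in>Cb T. ((\<lambda>_. \<psi> h) \<longlongrightarrow> E \<psi>) U"
        using ultrafilter_limit_in_Cb_dual[where h="\<lambda>_. h", OF U h] by (rule bexE)
      have ev: "E \<psi> = \<psi> h" if "\<psi> \<in> Cb T" for \<psi>
        using ELim[rule_format, OF that] by (simp add: tendsto_const_iff nb)
      have "openin (weak_topology T) {f \<in> Cb T. E f \<in> - {\<phi> h}}"
        using openin_continuous_map_preimage[OF continuous_map_weak_topology[OF E], of "- {\<phi> h}"]
        by (simp add: topspace_weak_topology open_Compl)
      then have "\<exists>y\<in>{\<phi>}. y \<in> {f \<in> Cb T. E f \<in> - {\<phi> h}}"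
        using cl[unfolded in_closure_of, THEN conjunct2, rule_format,
            of "{f \<in> Cb T. E f \<in> - {\<phi> h}}"] ev[OF \<psi>] ne \<psi> by simp
      then show False using ev \<phi> by simp
    qed
    then show "\<psi> \<in> {\<phi>}"
      using \<psi> \<phi> by (auto simp: Cb_def intro: extensionalityI[of _ "topspace T"])
  qed
  then have "weak_topology T closure_of ((\<lambda>g. translate G g \<phi>) ` carrier G) \<subseteq> {\<phi>}"
    using closure_of_mono[OF sub] by (meson order_trans)
  then have "compactin (weak_topology T) (weak_topology T closure_of ((\<lambda>g. translate G g \<phi>) ` carrier G))"
    by (intro finite_imp_compactin)
       (auto simp: \<phi> topspace_weak_topology intro: finite_subset)
  then show ?thesis using \<phi> unfolding \<phi>_def WAP_def by simp
qed

text \<open>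
  A character is determined by its value at the unit, which is a nonzero idempotent number.
\<close>

lemma characters_of_constants:
  assumes A: "A = {\<lambda>h\<in>S. c | c. True}" and e: "e \<in> S"
  shows "characters S A = {\<lambda>\<phi>\<in>A. \<phi> e}"
proof
  have mem: "(\<lambda>h\<in>S. c) \<in> A" for c by (auto simp: A)
  have rep: "\<phi> = (\<lambda>h\<in>S. \<phi> e)" if "\<phi> \<in> A" for \<phi> using that e by (auto simp: A)
  show "{\<lambda>\<phi>\<in>A. \<phi> e} \<subseteq> characters S A"
  proof -
    have "(\<lambda>h\<in>S. \<phi> h + \<psi> h) \<in> A" "(\<lambda>h\<in>S. \<phi> h * \<psi> h) \<in> A" if AA: "\<phi> \<in> A" "\<psi> \<in> A" for \<phi> \<psi>
    proof -
      obtain c d where "\<phi> = (\<lambda>h\<in>S. c)" "\<psi> = (\<lambda>h\<in>S. d)" using AA A by auto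
      then have "(\<lambda>h\<in>S. \<phi> h + \<psi> h) = (\<lambda>h\<in>S. c + d)" "(\<lambda>h\<in>S. \<phi> h * \<psi> h) = (\<lambda>h\<in>S. c * d)" by auto
      then show "(\<lambda>h\<in>S. \<phi> h + \<psi> h) \<in> A" "(\<lambda>h\<in>S. \<phi> h * \<psi> h) \<in> A" using mem by auto
    qed
    moreover have "(\<lambda>h\<in>S. k * \<phi> h) \<in> A" if AA: "\<phi> \<in> A" for k \<phi>
    proof -
      obtain c where "\<phi> = (\<lambda>h\<in>S. c)" using AA A by auto
      then have "(\<lambda>h\<in>S. k * \<phi> h) = (\<lambda>h\<in>S. k * c)" by auto
      then show ?thesis using mem by auto
    qed
    moreover have "\<exists>\<phi>\<in>A. \<phi> e \<noteq> 0" using e mem[of 1] by (intro bexI[of _ "\<lambda>h\<in>S. 1"]) auto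
    ultimately show ?thesis
      using e unfolding characters_def linear_functional_on_def by auto
  qed
  show "characters S A \<subseteq> {\<lambda>\<phi>\<in>A. \<phi> e}"
  proof
    fix \<xi> assume "\<xi> \<in> characters S A"
    then have ext: "\<xi> \<in> extensional A"
      and scale: "\<And>c \<phi>. \<phi> \<in> A \<Longrightarrow> \<xi> (\<lambda>h\<in>S. c * \<phi> h) = c * \<xi> \<phi>"
      and mult: "\<And>\<phi> \<psi>. \<phi> \<in> A \<Longrightarrow> \<psi> \<in> A \<Longrightarrow> \<xi> (\<lambda>h\<in>S. \<phi> h * \<psi> h) = \<xi> \<phi> * \<xi> \<psi>"
      and nz: "\<exists>\<phi>\<in>A. \<xi> \<phi> \<noteq> 0"
      unfolding characters_def linear_functional_on_def by auto
    define u :: "_ \<Rightarrow> complex" where "u = (\<lambda>h\<in>S. 1)"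
    have u: "u \<in> A" unfolding u_def by (rule mem)
    have val: "\<xi> \<phi> = \<phi> e * \<xi> u" if "\<phi> \<in> A" for \<phi>
    proof -
      have "(\<lambda>h\<in>S. \<phi> e * u h) = (\<lambda>h\<in>S. \<phi> e)" by (auto simp: u_def)
      then have "\<xi> (\<lambda>h\<in>S. \<phi> e) = \<phi> e * \<xi> u" using scale[OF u, of "\<phi> e"] by simp
      then show ?thesis by (simp only: rep[OF that, symmetric])
    qed
    have "u = (\<lambda>h\<in>S. u h * u h)" by (auto simp: u_def)
    then have "\<xi> u = \<xi> u * \<xi> u" using mult[OF u u] by simp
    moreover have "\<xi> u \<noteq> 0" using nz val by force
    ultimately have "\<xi> u = 1" by simp
    then have "\<xi> = (\<lambda>\<phi>\<in>A. \<phi> e)" using val ext by (intro extensionalityI[of _ A]) auto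
    then show "\<xi> \<in> {\<lambda>\<phi>\<in>A. \<phi> e}" by simp
  qed
qed

section \<open>The automorphism group of a cyclic order and its topology\<close>

lemma Aut_iff: "f \<in> Aut R \<Longrightarrow> R (f a) (f b) (f c) \<longleftrightarrow> R a b c"
  by (simp add: Aut_def)

lemma Aut_id: "id \<in> Aut R"
  by (simp add: Aut_def)

lemma Aut_comp: "f \<in> Aut R \<Longrightarrow> g \<in> Aut R \<Longrightarrow> f \<circ> g \<in> Aut R"
  by (auto simp: Aut_def intro: bij_comp)

lemma Aut_inv:
  assumes "f \<in> Aut R"
  shows "inv_into UNIV f \<in> Aut R" "f \<circ> inv_into UNIV f = id" "inv_into UNIV f \<circ> f = id"
    "f (inv_into UNIV f x) = x" "inv_into UNIV f (f x) = x"
proof -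
  have f: "bij f" using assms by (simp add: Aut_def)
  then show s: "f (inv_into UNIV f x) = x" "inv_into UNIV f (f x) = x" for x
    by (simp_all add: bij_is_surj surj_f_inv_f bij_is_inj)
  then show "f \<circ> inv_into UNIV f = id" "inv_into UNIV f \<circ> f = id" by auto
  have "R a b c \<longleftrightarrow> R (inv_into UNIV f a) (inv_into UNIV f b) (inv_into UNIV f c)" for a b c
    using Aut_iff[OF assms, of "inv_into UNIV f a" "inv_into UNIV f b" "inv_into UNIV f c"] by (simp add: s)
  then show "inv_into UNIV f \<in> Aut R" using f by (simp add: Aut_def bij_imp_bij_inv)
qed

context cyclic_order
begin

lemma topspace_interval_topology: "topspace (interval_topology R) = UNIV"
proof -
  have "openin (interval_topology R) UNIV"
    using in_some_interval by (simp add: openin_interval_topology_iff)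
  then show ?thesis using openin_subset by blast
qed

lemma topspace_aut: "topspace (aut_topology R) = Aut R"
  by (simp add: aut_topology_def topspace_interval_topology)

lemma Aut_continuous:
  assumes y: "y \<in> Aut R"
  shows "continuous_map (interval_topology R) (interval_topology R) y"
proof -
  have "openin (interval_topology R) {x. y x \<in> W}" if W: "openin (interval_topology R) W" for W
    unfolding openin_interval_topology_iff
  proof
    fix x assume "x \<in> {x. y x \<in> W}"
    then obtain a b where ab: "R a (y x) b" "cyclic_interval R a b \<subseteq> W"
      using W unfolding openin_interval_topology_iff cyclic_interval_def by blast
    have iff: "R (inv_into UNIV y a) z (inv_into UNIV y b) \<longleftrightarrow> R a (y z) b" for z
      using Aut_iff[OF y, of "inv_into UNIV y a" z "inv_into UNIV y b"] by (simp add: Aut_inv[OF y])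
    show "\<exists>a b. x \<in> cyclic_interval R a b \<and> cyclic_interval R a b \<subseteq> {x. y x \<in> W}"
      using ab iff unfolding cyclic_interval_def by blast
  qed
  then show ?thesis by (simp add: continuous_map_def topspace_interval_topology)
qed

lemma continuous_map_evaluation:
  "continuous_map (aut_topology R) (interval_topology R) (\<lambda>v. v x)"
  unfolding aut_topology_def
  by (intro continuous_map_from_subtopology continuous_map_product_projection) simp

lemma continuous_map_into_aut:
  assumes "\<And>x. continuous_map T (interval_topology R) (\<lambda>v. F v x)"
    and "\<And>v. v \<in> topspace T \<Longrightarrow> F v \<in> Aut R"
  shows "continuous_map T (aut_topology R) F"
  unfolding aut_topology_def continuous_map_in_subtopology
  using assms by (auto simp: continuous_map_componentwise_UNIV)

lemma continuous_map_comp_right: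
  assumes "y \<in> Aut R"
  shows "continuous_map (aut_topology R) (aut_topology R) (\<lambda>v. v \<circ> y)"
  by (rule continuous_map_into_aut)
     (use assms in \<open>auto simp: topspace_aut continuous_map_evaluation Aut_comp\<close>)

lemma continuous_map_comp_left:
  assumes "y \<in> Aut R"
  shows "continuous_map (aut_topology R) (aut_topology R) (\<lambda>v. y \<circ> v)"
proof (rule continuous_map_into_aut)
  show "continuous_map (aut_topology R) (interval_topology R) (\<lambda>v. (y \<circ> v) x)" for x
    using continuous_map_compose[OF continuous_map_evaluation Aut_continuous[OF assms], of x]
    by (simp add: comp_def)
qed (use assms in \<open>auto simp: topspace_aut Aut_comp\<close>)

lemma tendsto_nhdsin_id:
  fixes \<phi> :: "('a \<Rightarrow> 'a) \<Rightarrow> complex"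
  assumes "continuous_map (aut_topology R) euclidean \<phi>"
    and F: "continuous_map (aut_topology R) (aut_topology R) F"
  shows "((\<lambda>v. \<phi> (F v)) \<longlongrightarrow> \<phi> (F id)) (nhdsin (aut_topology R) id)"
  unfolding tendsto_def
proof safe
  fix S :: "complex set" assume S: "open S" "\<phi> (F id) \<in> S"
  have "continuous_map (aut_topology R) euclidean (\<phi> \<circ> F)"
    using F assms(1) by (rule continuous_map_compose)
  then have "openin (aut_topology R) {v \<in> Aut R. \<phi> (F v) \<in> S}"
    using S(1) openin_continuous_map_preimage[of "aut_topology R" euclidean "\<phi> \<circ> F" S]
    by (simp add: topspace_aut)
  then show "eventually (\<lambda>v. \<phi> (F v) \<in> S) (nhdsin (aut_topology R) id)"
    unfolding eventually_nhdsin using S(2) Aut_id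
    by (intro disjI2 exI[of _ "{v \<in> Aut R. \<phi> (F v) \<in> S}"]) auto
qed

lemma rotate_to_base: "R a b c \<longleftrightarrow> R b c a"
  by (meson cyclicity)

lemma from_trans: "R p a b \<Longrightarrow> R p b c \<Longrightarrow> R p a c"
  by (rule transitivity)

lemma from_asym: "R p a b \<Longrightarrow> \<not> R p b a"
  using asymmetry rotate_to_base by blast

lemma from_total: "a \<noteq> b \<Longrightarrow> a \<noteq> p \<Longrightarrow> b \<noteq> p \<Longrightarrow> R p a b \<or> R p b a"
  using completeness[of p a b] by blast

lemma from_increasing_triple: "R p a b \<Longrightarrow> R p b c \<Longrightarrow> R a b c"
  by (meson cyclicity transitivity)

text \<open>
  Reduces arbitrary triples to the linear order obtained by cutting at \<open>p\<close>: a positively oriented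
  triple is one of the three rotations of an increasing one.
\<close>

lemma cut_at_base:
  assumes "p \<noteq> a" "p \<noteq> x" "p \<noteq> b"
  shows "R a x b \<longleftrightarrow> (R p a x \<and> R p x b) \<or> (R p x b \<and> R p b a) \<or> (R p b a \<and> R p a x)"
proof
  assume axb: "R a x b"
  then have ne: "a \<noteq> x" "x \<noteq> b" "a \<noteq> b" using distinct_of by auto
  have no: "\<not> R x a b" using asymmetry[OF axb] .
  have no': "\<not> R a b x" "\<not> R b x a" using no rotate_to_base by blast+
  show "(R p a x \<and> R p x b) \<or> (R p x b \<and> R p b a) \<or> (R p b a \<and> R p a x)"
    using from_total[of a x p] from_total[of x b p] from_total[of a b p] assms ne no no'
      from_increasing_triple[of p x a b] from_increasing_triple[of p a b x]
      from_increasing_triple[of p b x a] by blast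
next
  assume "(R p a x \<and> R p x b) \<or> (R p x b \<and> R p b a) \<or> (R p b a \<and> R p a x)"
  then show "R a x b"
    using from_increasing_triple[of p a x b] from_increasing_triple[of p x b a]
      from_increasing_triple[of p b a x] rotate_to_base by blast
qed

text \<open>
  The automorphisms fixing \<open>p\<close> that move no point of \<open>T\<close> as far as another point of \<open>T\<close>. These sets
  are stable under inversion and shrink as \<open>T\<close> grows. They do not require points of \<open>T\<close> to be fixed,
  which is where the interval topology on the points, rather than the discrete one, matters.
\<close>

definition nearly_fixing :: "'a \<Rightarrow> 'a set \<Rightarrow> ('a \<Rightarrow> 'a) set" where
  "nearly_fixing p T = {v \<in> Aut R. v p = p \<and>
     (\<forall>s\<in>T. \<forall>t\<in>T. R p s t \<longrightarrow> R p (v s) t \<and> R p s (v t))}"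

text \<open>
  The end points of the interval belong to \<open>T\<close>, and the image of \<open>x\<close> cannot reach them. The point \<open>p\<close>
  is exempt as it does not move at all.
\<close>

lemma nearly_fixing_keeps_interval:
  assumes v: "v \<in> nearly_fixing p T" and axb: "R a x b" and T: "{a, x, b} - {p} \<subseteq> T"
  shows "R a (v x) b"
proof -
  have vA: "v \<in> Aut R" and vp: "v p = p"
    and vT: "\<And>s t. s \<in> T \<Longrightarrow> t \<in> T \<Longrightarrow> R p s t \<Longrightarrow> R p (v s) t \<and> R p s (v t)"
    using v unfolding nearly_fixing_def by auto
  have ne: "a \<noteq> x" "x \<noteq> b" "a \<noteq> b" using distinct_of[OF axb] by auto
  consider "x = p" | "a = p" | "b = p" | "p \<noteq> a" "p \<noteq> x" "p \<noteq> b" by blast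
  then show ?thesis
  proof cases
    case 1
    then show ?thesis using vp axb by simp
  next
    case 2
    then have "x \<in> T" "b \<in> T" "R p x b" using T ne axb by auto
    then show ?thesis using vT 2 by blast
  next
    case 3
    then have "x \<in> T" "a \<in> T" "R p a x" using T ne axb rotate_to_base by auto
    then show ?thesis using vT 3 rotate_to_base by blast
  next
    case 4
    then have inT: "a \<in> T" "x \<in> T" "b \<in> T" using T by auto
    have vx: "p \<noteq> v x" using Aut_inv(5)[OF vA] vp 4(2) by metis
    have "R p a x \<Longrightarrow> R p a (v x)" "R p x b \<Longrightarrow> R p (v x) b"
      using vT[OF inT(1,2)] vT[OF inT(2,3)] by auto
    then show ?thesis
      using axb unfolding cut_at_base[OF 4] cut_at_base[OF 4(1) vx 4(3)] by blast
  qed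
qed

text \<open>
  A basic neighbourhood of the identity prescribes intervals around finitely many points; \<open>T\<close> collects
  these points and the end points of the intervals.
\<close>

lemma nearly_fixing_neighbourhood:
  assumes "eventually P (nhdsin (aut_topology R) id)"
  shows "\<exists>T. finite T \<and> p \<notin> T \<and> (\<forall>v\<in>nearly_fixing p T. P v)"
proof -
  obtain W where W: "openin (aut_topology R) W" "id \<in> W" "\<And>v. v \<in> W \<Longrightarrow> P v"
    using assms Aut_id by (auto simp: eventually_nhdsin topspace_aut)
  obtain W' where W': "openin (product_topology (\<lambda>x. interval_topology R) UNIV) W'"
      "W = W' \<inter> Aut R"
    using W(1) unfolding aut_topology_def openin_subtopology by blast
  obtain V where V: "id \<in> PiE UNIV V" "\<And>x. openin (interval_topology R) (V x)"
      "finite {x. V x \<noteq> UNIV}" "PiE UNIV V \<subseteq> W'"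
    using product_topology_open_contains_basis[OF W'(1), of id] W(2) W'(2)
    by (auto simp: topspace_interval_topology)
  have "\<exists>a b. R a x b \<and> cyclic_interval R a b \<subseteq> V x" for x
  proof -
    have "x \<in> V x" using V(1) by (auto simp: PiE_iff)
    then show ?thesis
      using V(2)[of x] unfolding openin_interval_topology_iff by (auto simp: cyclic_interval_def)
  qed
  then obtain a b where ab: "\<And>x. R (a x) x (b x)" "\<And>x. cyclic_interval R (a x) (b x) \<subseteq> V x"
    by metis
  define A where "A = {x. V x \<noteq> UNIV}"
  define T where "T = (\<Union>x\<in>A. {a x, x, b x}) - {p}"
  have "P v" if v: "v \<in> nearly_fixing p T" for v
  proof -
    have "v x \<in> V x" for x
    proof (cases "x \<in> A")
      case True
      then have "R (a x) (v x) (b x)"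
        by (intro nearly_fixing_keeps_interval[OF v] ab(1)) (auto simp: T_def)
      then show ?thesis using ab(2)[of x] by (auto simp: cyclic_interval_def)
    next
      case False
      then have "V x = UNIV" by (simp add: A_def)
      then show ?thesis by simp
    qed
    then have "v \<in> PiE UNIV V" by (simp add: PiE_iff)
    moreover have "v \<in> Aut R" using v by (simp add: nearly_fixing_def)
    ultimately show ?thesis using V(4) W'(2) W(3) by blast
  qed
  moreover have "finite T" "p \<notin> T" using V(3) by (auto simp: T_def A_def)
  ultimately show ?thesis by blast
qed

section \<open>Increasing maps in an ultrahomogeneous cyclic order\<close>

lemma sorted_enumeration:
  assumes "finite T" "p \<notin> T"
  shows "\<exists>xs. set xs = T \<and> sorted_wrt (R p) xs"
  using assms
proof (induction T)
  case empty
  show ?case by (intro exI[of _ "[]"]) simp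
next
  case (insert x T)
  then obtain xs where xs: "set xs = T" "sorted_wrt (R p) xs" by auto
  define ys where "ys = filter (\<lambda>y. R p y x) xs @ x # filter (\<lambda>y. R p x y) xs"
  have "R p y x \<or> R p x y" if "y \<in> T" for y
    using that insert.hyps(2) insert.prems by (intro from_total) auto
  then have "set ys = insert x T" using xs(1) by (auto simp: ys_def)
  moreover have "sorted_wrt (R p) ys"
    unfolding ys_def using xs(2)
    by (auto simp: sorted_wrt_append sorted_wrt_filter intro: from_trans)
  ultimately show ?case by blast
qed

lemma cycle_tuple_sorted:
  assumes "sorted_wrt (R p) xs" "p \<notin> set xs"
  shows "cycle_tuple R (p # xs)"
proof -
  have lt: "R p (xs ! i) (xs ! j)" if "i < j" "j < length xs" for i j
    using assms(1) that by (rule sorted_wrt_nth_less)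
  have "R ((p # xs) ! i) ((p # xs) ! j) ((p # xs) ! k)"
    if ijk: "i < j" "j < k" "k < length (p # xs)" for i j k
  proof -
    obtain j' k' where jk: "j = Suc j'" "k = Suc k'" using ijk by (cases j; cases k) auto
    show ?thesis
    proof (cases i)
      case 0
      then show ?thesis using jk ijk lt by simp
    next
      case (Suc i')
      then show ?thesis using jk ijk lt from_increasing_triple[of p] by simp
    qed
  qed
  moreover have "p \<noteq> xs ! 0" if "length xs = 1" using assms(2) that by (cases xs) auto
  moreover have "length xs = 0 \<or> length xs = 1 \<or> length xs \<ge> 2" by linarith
  ultimately show ?thesis unfolding cycle_tuple_def by auto
qed

lemma from_increasing_sequence:
  assumes "\<And>m. R p (w m) (w (Suc m))" "i < j"
  shows "R p (w i) (w j)"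
  using assms(2) by (induction rule: less_Suc_induct) (auto intro: assms(1) from_trans)

end

text \<open>
  The lexicographic order of type \<open>\<omega>\<^sup>2\<close>: each row contains an infinite increasing sequence of
  slots that stays below all later rows.
\<close>

definition slot_less :: "nat \<times> nat \<Rightarrow> nat \<times> nat \<Rightarrow> bool" where
  "slot_less P Q \<longleftrightarrow> fst P < fst Q \<or> (fst P = fst Q \<and> snd P < snd Q)"

locale ultrahomogeneous_cyclic_order = cyclic_order +
  assumes homogeneous: "ultrahomogeneous R"
begin

text \<open>
  Ultrahomogeneity seen from \<open>p\<close>: putting \<open>p\<close> in front of an increasing tuple gives a cycle.
\<close>

lemma extend_increasing_map:
  assumes "finite T" "p \<notin> T" and img: "\<And>t. t \<in> T \<Longrightarrow> \<sigma> t \<noteq> p"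
    and incr: "\<And>s t. s \<in> T \<Longrightarrow> t \<in> T \<Longrightarrow> R p s t \<Longrightarrow> R p (\<sigma> s) (\<sigma> t)"
  shows "\<exists>g\<in>Aut R. g p = p \<and> (\<forall>t\<in>T. g t = \<sigma> t)"
proof -
  obtain xs where xs: "set xs = T" "sorted_wrt (R p) xs"
    using sorted_enumeration assms(1,2) by blast
  have "sorted_wrt (R p) (map \<sigma> xs)"
    unfolding sorted_wrt_map using xs(2)
    by (rule sorted_wrt_mono_rel[rotated]) (use incr xs(1) in auto)
  then have "cycle_tuple R (p # map \<sigma> xs)"
    using img xs(1) by (intro cycle_tuple_sorted) auto
  moreover have "cycle_tuple R (p # xs)"
    using xs assms(2) by (intro cycle_tuple_sorted) auto
  ultimately obtain g where "g \<in> Aut R" "map g (p # xs) = p # map \<sigma> xs"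
    using homogeneous unfolding ultrahomogeneous_def
    by (metis length_map list.size(4))
  then show ?thesis using xs(1) by (intro bexI[of _ g]) auto
qed

text \<open>
  Some interval is nonempty because there are three points, and automorphisms act transitively on
  pairs of distinct points.
\<close>

lemma between:
  assumes "a \<noteq> b"
  shows "\<exists>c. R a c b"
proof -
  obtain x y z where "R x z y" using three_points completeness by metis
  moreover from this have "x \<noteq> y" using distinct_of by blast
  then have "cycle_tuple R [x, y]" "cycle_tuple R [a, b]"
    using assms by (auto simp: cycle_tuple_def)
  then obtain g where "g \<in> Aut R" "map g [x, y] = [a, b]"
    using homogeneous unfolding ultrahomogeneous_def
    by (metis length_Cons list.size(3))
  ultimately have "R a (g z) b" using Aut_iff[of g R x z y] by simp
  then show ?thesis ..
qed

lemma from_dense: "R p a b \<Longrightarrow> \<exists>c. R p a c \<and> R p c b"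
proof -
  assume pab: "R p a b"
  then obtain c where c: "R a c b" using between[of a b] distinct_of by blast
  have "R a c p" using c pab rotate_to_base transitivity by blast
  moreover have "R b p c" using c pab rotate_to_base transitivity by blast
  ultimately show ?thesis using rotate_to_base by blast
qed

lemma from_unbounded:
  assumes "x \<noteq> p"
  shows "\<exists>c. R p x c" "\<exists>c. R p c x"
  using between[of x p] between[of p x] assms rotate_to_base by blast+

lemma finite_lower_bound:
  assumes "finite T" "p \<notin> T"
  shows "\<exists>u. u \<noteq> p \<and> (\<forall>t\<in>T. R p u t)"
  using assms
proof (induction T)
  case empty
  have "\<exists>u. u \<noteq> p" using three_points by metis
  then show ?case by simp
next
  case (insert x T)
  then obtain u where u: "u \<noteq> p" "\<forall>t\<in>T. R p u t" by auto
  have "x \<noteq> p" using insert.prems by auto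
  then obtain c where c: "R p c x" using from_unbounded(2) by blast
  show ?case
  proof (cases "R p u x")
    case True
    then show ?thesis using u by blast
  next
    case False
    then have "u = x \<or> R p x u" using from_total[of u x p] u(1) \<open>x \<noteq> p\<close> by blast
    then have "R p c u" using c from_trans by blast
    then have "\<forall>t\<in>insert x T. R p c t" using u(2) c from_trans by blast
    moreover have "c \<noteq> p" using distinct_of[OF c] by auto
    ultimately show ?thesis by blast
  qed
qed

lemma finite_upper_bound:
  assumes "finite T" "p \<notin> T"
  shows "\<exists>u. u \<noteq> p \<and> (\<forall>t\<in>T. R p t u)"
  using assms
proof (induction T)
  case empty
  have "\<exists>u. u \<noteq> p" using three_points by metis
  then show ?case by simp
next
  case (insert x T)
  then obtain u where u: "u \<noteq> p" "\<forall>t\<in>T. R p t u" by auto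
  have "x \<noteq> p" using insert.prems by auto
  then obtain c where c: "R p x c" using from_unbounded(1) by blast
  show ?case
  proof (cases "R p x u")
    case True
    then show ?thesis using u by blast
  next
    case False
    then have "u = x \<or> R p u x" using from_total[of u x p] u(1) \<open>x \<noteq> p\<close> by blast
    then have "R p u c" using c from_trans by blast
    then have "\<forall>t\<in>insert x T. R p t c" using u(2) c from_trans by blast
    moreover have "c \<noteq> p" using distinct_of[OF c] by auto
    ultimately show ?thesis by blast
  qed
qed

text \<open>
  Enclose \<open>T\<close> between a lower bound and an upper bound and move these two points to \<open>u\<close> and \<open>v\<close>.
\<close>

lemma copy_into_interval:
  assumes "R p u v" "finite T" "p \<notin> T"
  shows "\<exists>\<sigma>. (\<forall>t\<in>T. R p u (\<sigma> t) \<and> R p (\<sigma> t) v) \<and>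
    (\<forall>s\<in>T. \<forall>t\<in>T. R p s t \<longrightarrow> R p (\<sigma> s) (\<sigma> t))"
proof -
  obtain l where l: "l \<noteq> p" "\<forall>t\<in>T. R p l t" using finite_lower_bound assms by blast
  obtain w where w: "w \<noteq> p" "\<forall>t\<in>insert l T. R p t w"
    using finite_upper_bound[of "insert l T" p] assms l(1) by blast
  have lw: "R p l w" using w by blast
  then have "l \<noteq> w" using distinct_of by blast
  have nl: "\<not> R p w l" "\<not> R p l l" "\<not> R p w w" using from_asym[OF lw] from_asym by blast+
  have "\<exists>g\<in>Aut R. g p = p \<and> (\<forall>t\<in>{l, w}. g t = (if t = l then u else v))"
    using distinct_of[OF assms(1)] l(1) w(1) assms(1) \<open>l \<noteq> w\<close> nl
    by (intro extend_increasing_map) auto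
  then obtain g where g: "g \<in> Aut R" "g p = p" "g l = u" "g w = v"
    using \<open>l \<noteq> w\<close> by auto
  have iff: "R p (g a) (g b) \<longleftrightarrow> R p a b" for a b
    using Aut_iff[OF g(1), of p a b] g(2) by simp
  show ?thesis
    using l(2) w(2) iff g(3,4) by (intro exI[of _ g]) (auto simp: g(3,4)[symmetric])
qed

lemma increasing_sequence_between:
  assumes "R p a b"
  shows "\<exists>w :: nat \<Rightarrow> 'a. \<forall>m. (R p a (w m) \<and> R p (w m) b) \<and> R p (w m) (w (Suc m))"
proof (rule dependent_nat_choice)
  show "\<exists>x. R p a x \<and> R p x b" by (rule from_dense[OF assms])
  show "\<exists>y. (R p a y \<and> R p y b) \<and> R p x y" if "R p a x \<and> R p x b" for x
    using from_dense[of p x b] that from_trans by blast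
qed

lemma lexicographic_grid:
  "\<exists>z :: nat \<times> nat \<Rightarrow> 'a. \<forall>P Q. slot_less P Q \<longrightarrow> R p (z P) (z Q)"
proof -
  have "\<exists>u :: nat \<Rightarrow> 'a. \<forall>n. u n \<noteq> p \<and> R p (u n) (u (Suc n))"
  proof (rule dependent_nat_choice)
    show "\<exists>x. x \<noteq> p" using three_points by metis
    show "\<exists>y. y \<noteq> p \<and> R p x y" if "x \<noteq> p" for x
      using from_unbounded(1)[OF that] distinct_of by metis
  qed
  then obtain u :: "nat \<Rightarrow> 'a" where u: "\<And>n. R p (u n) (u (Suc n))" by blast
  obtain w :: "nat \<Rightarrow> nat \<Rightarrow> 'a" where
    w: "\<And>n m. R p (u n) (w n m)" "\<And>n m. R p (w n m) (u (Suc n))"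
      "\<And>n m. R p (w n m) (w n (Suc m))"
    using increasing_sequence_between[OF u] by metis
  have "R p (w a m) (w b n)" if "a < b \<or> a = b \<and> m < n" for a b m n
  proof (cases "a = b")
    case True
    then have "m < n" using that by auto
    then show ?thesis unfolding True using from_increasing_sequence[of p "w b", OF w(3)] by blast
  next
    case False
    then have ab: "a < b" using that by auto
    have "R p (w a m) (u b)"
    proof (cases "Suc a = b")
      case True
      then show ?thesis using w(2)[of a m] by simp
    next
      case False
      then have "Suc a < b" using ab by simp
      then have "R p (u (Suc a)) (u b)" using from_increasing_sequence[of p u, OF u] by blast
      with w(2) show ?thesis by (rule from_trans)
    qed
    then show ?thesis using w(1) by (rule from_trans)
  qed
  then show ?thesis
    by (intro exI[of _ "\<lambda>P. w (fst P) (snd P)"]) (auto simp: slot_less_def)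
qed

section \<open>Interleaving patterns of a finite set and its image\<close>

text \<open>
  Slot \<open>P\<close> is the interval between the grid points \<open>P\<close> and its successor in the same row. Points
  assigned to a common slot keep their order because each slot receives a copy of all of \<open>T\<close>.
\<close>

lemma place_in_slots:
  assumes z: "\<And>P Q. slot_less P Q \<Longrightarrow> R p (z P) (z Q)"
    and T: "finite T" "p \<notin> T"
    and c: "\<And>s t. s \<in> T \<Longrightarrow> t \<in> T \<Longrightarrow> R p s t \<Longrightarrow> c s = c t \<or> slot_less (c s) (c t)"
  shows "\<exists>\<sigma>. (\<forall>t\<in>T. R p (z (c t)) (\<sigma> t) \<and> R p (\<sigma> t) (z (fst (c t), Suc (snd (c t))))) \<and>
    (\<forall>s\<in>T. \<forall>t\<in>T. R p s t \<longrightarrow> R p (\<sigma> s) (\<sigma> t))"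
proof -
  have "\<exists>\<sigma>. (\<forall>t\<in>T. R p (z P) (\<sigma> t) \<and> R p (\<sigma> t) (z (fst P, Suc (snd P)))) \<and>
      (\<forall>s\<in>T. \<forall>t\<in>T. R p s t \<longrightarrow> R p (\<sigma> s) (\<sigma> t))" for P
    using T by (intro copy_into_interval z) (auto simp: slot_less_def)
  then obtain \<sigma> where \<sigma>:
    "\<And>P t. t \<in> T \<Longrightarrow> R p (z P) (\<sigma> P t) \<and> R p (\<sigma> P t) (z (fst P, Suc (snd P)))"
    "\<And>P s t. s \<in> T \<Longrightarrow> t \<in> T \<Longrightarrow> R p s t \<Longrightarrow> R p (\<sigma> P s) (\<sigma> P t)"
    by metis
  have "R p (\<sigma> (c s) s) (\<sigma> (c t) t)" if st: "s \<in> T" "t \<in> T" "R p s t" for s t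
  proof (cases "c s = c t")
    case True
    then show ?thesis using \<sigma>(2) st by simp
  next
    case False
    then have less: "slot_less (c s) (c t)" using c st by blast
    have "(fst (c s), Suc (snd (c s))) = c t \<or> slot_less (fst (c s), Suc (snd (c s))) (c t)"
      using less unfolding slot_less_def by (cases "c t") auto
    then have "z (fst (c s), Suc (snd (c s))) = z (c t) \<or>
        R p (z (fst (c s), Suc (snd (c s)))) (z (c t))"
      using z by metis
    then have "R p (\<sigma> (c s) s) (z (c t))" using \<sigma>(1)[OF st(1), of "c s"] from_trans by metis
    then show ?thesis using \<sigma>(1)[OF st(2), of "c t"] from_trans by blast
  qed
  with \<sigma>(1) show ?thesis by (intro exI[of _ "\<lambda>t. \<sigma> (c t) t"]) simp
qed

lemma slots_separate:
  assumes z: "\<And>P Q. slot_less P Q \<Longrightarrow> R p (z P) (z Q)"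
    and PQ: "slot_less P Q"
    and x: "R p x (z (fst P, Suc (snd P)))" and y: "R p (z Q) y"
  shows "R p x y"
proof -
  have "(fst P, Suc (snd P)) = Q \<or> slot_less (fst P, Suc (snd P)) Q"
    using PQ unfolding slot_less_def by (cases Q) auto
  then have "z (fst P, Suc (snd P)) = z Q \<or> R p (z (fst P, Suc (snd P))) (z Q)"
    using z by metis
  then show ?thesis using x y from_trans by metis
qed

definition stabilizer :: "'a \<Rightarrow> ('a \<Rightarrow> 'a) set" where
  "stabilizer p = {g \<in> Aut R. g p = p}"

lemma stabilizer_comp: "g \<in> stabilizer p \<Longrightarrow> h \<in> stabilizer p \<Longrightarrow> g \<circ> h \<in> stabilizer p"
  by (simp add: stabilizer_def Aut_comp)

lemma stabilizer_inv:
  assumes "g \<in> stabilizer p" shows "inv_into UNIV g \<in> stabilizer p"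
proof -
  have g: "g \<in> Aut R" "g p = p" using assms by (auto simp: stabilizer_def)
  then have "inv_into UNIV g p = p" using Aut_inv(5)[OF g(1), of p] by simp
  then show ?thesis using Aut_inv(1)[OF g(1)] by (simp add: stabilizer_def)
qed

lemma stabilizer_increasing: "g \<in> stabilizer p \<Longrightarrow> R p (g a) (g b) \<longleftrightarrow> R p a b"
  using Aut_iff[of g R p a b] by (simp add: stabilizer_def)

text \<open>
  The relation \<open>\<omega> s t\<close> prescribes \<open>s < g t\<close>; otherwise \<open>g t < s\<close> is required, so coincidences are
  excluded.
\<close>

definition pattern :: "'a \<Rightarrow> 'a set \<Rightarrow> ('a \<Rightarrow> 'a \<Rightarrow> bool) \<Rightarrow> ('a \<Rightarrow> 'a) set" where
  "pattern p T \<omega> = {g \<in> stabilizer p.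
     \<forall>s\<in>T. \<forall>t\<in>T. if \<omega> s t then R p s (g t) else R p (g t) s}"

text \<open>
  Think of \<open>r\<close> as numbering consecutive blocks \<open>Q\<^sub>0 < Q\<^sub>1 < \<dots>\<close> of \<open>T\<close>. Here the blocks up to
  \<open>Q\<^sub>k\<close> count as a single one, and the pattern is that each block is followed by its image:
  \<open>D < g D < Q\<^bsub>k+1\<^esub> < g Q\<^bsub>k+1\<^esub> < \<dots>\<close> with \<open>D = Q\<^sub>0 \<union> \<dots> \<union> Q\<^sub>k\<close>.
\<close>

definition merge_pattern :: "'a \<Rightarrow> 'a set \<Rightarrow> ('a \<Rightarrow> nat) \<Rightarrow> nat \<Rightarrow> ('a \<Rightarrow> 'a) set" where
  "merge_pattern p T r k = pattern p T (\<lambda>s t. max (r s) k \<le> max (r t) k)"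

text \<open>
  Passing from \<open>k\<close> to \<open>k + 1\<close> exchanges the adjacent blocks \<open>g D\<close> and \<open>Q\<^bsub>k+1\<^esub>\<close> of the pattern
  \<open>D < g D < Q\<^bsub>k+1\<^esub> < g Q\<^bsub>k+1\<^esub> < \<dots>\<close>. Comparing \<open>T\<close> with its image under \<open>g\<^sub>i \<circ> h\<^sub>j\<close> amounts to
  comparing the preimage of \<open>T\<close> under \<open>g\<^sub>i\<close> with its image under \<open>h\<^sub>j\<close>. It is therefore enough to
  place copies \<open>E\<^sub>i\<close> of \<open>Q\<^bsub>k+1\<^esub>\<close> and copies \<open>D'\<^sub>j\<close> of \<open>D\<close> alternately,
  \<open>E\<^sub>0 < D'\<^sub>0 < E\<^sub>1 < D'\<^sub>1 < \<dots>\<close>, and to keep all other blocks in place.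
\<close>

lemma merge_step_sequences:
  assumes T: "finite T" "p \<notin> T"
    and r: "\<And>s t. s \<in> T \<Longrightarrow> t \<in> T \<Longrightarrow> R p s t \<Longrightarrow> r s \<le> r t"
  shows "\<exists>g h :: nat \<Rightarrow> 'a \<Rightarrow> 'a. (\<forall>i. g i \<in> stabilizer p \<and> h i \<in> stabilizer p) \<and>
    (\<forall>i j. g i \<circ> h j \<in> merge_pattern p T r (if i \<le> j then Suc k else k))"
proof -
  obtain z :: "nat \<times> nat \<Rightarrow> 'a" where z: "\<And>P Q. slot_less P Q \<Longrightarrow> R p (z P) (z Q)"
    using lexicographic_grid by blast
  \<comment> \<open>Row \<open>1\<close> holds the alternating copies; the other blocks get one row each, even for \<open>T\<close>, odd for its image.\<close>
  define a where "a i t = (if r t \<le> k then (0, 0) else if r t = Suc k then (1, 2 * i) else (2 * r t, 0))"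
    for i :: nat and t
  define b where "b j t = (if r t \<le> k then (1, 2 * j + 1) else (2 * r t + 1, 0))"
    for j :: nat and t
  have "\<exists>\<sigma>. (\<forall>t\<in>T. R p (z (a i t)) (\<sigma> t) \<and> R p (\<sigma> t) (z (fst (a i t), Suc (snd (a i t))))) \<and>
    (\<forall>s\<in>T. \<forall>t\<in>T. R p s t \<longrightarrow> R p (\<sigma> s) (\<sigma> t))" for i
    using T z
  proof (intro place_in_slots)
    show "a i s = a i t \<or> slot_less (a i s) (a i t)" if "s \<in> T" "t \<in> T" "R p s t" for s t
      using r[OF that] unfolding a_def slot_less_def by auto
  qed
  then obtain \<alpha> where \<alpha>:
    "\<And>i t. t \<in> T \<Longrightarrow> R p (z (a i t)) (\<alpha> i t) \<and> R p (\<alpha> i t) (z (fst (a i t), Suc (snd (a i t))))"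
    "\<And>i s t. s \<in> T \<Longrightarrow> t \<in> T \<Longrightarrow> R p s t \<Longrightarrow> R p (\<alpha> i s) (\<alpha> i t)"
    by metis
  have "\<exists>\<sigma>. (\<forall>t\<in>T. R p (z (b j t)) (\<sigma> t) \<and> R p (\<sigma> t) (z (fst (b j t), Suc (snd (b j t))))) \<and>
    (\<forall>s\<in>T. \<forall>t\<in>T. R p s t \<longrightarrow> R p (\<sigma> s) (\<sigma> t))" for j
    using T z
  proof (intro place_in_slots)
    show "b j s = b j t \<or> slot_less (b j s) (b j t)" if "s \<in> T" "t \<in> T" "R p s t" for s t
      using r[OF that] unfolding b_def slot_less_def by auto
  qed
  then obtain \<beta> where \<beta>:
    "\<And>j t. t \<in> T \<Longrightarrow> R p (z (b j t)) (\<beta> j t) \<and> R p (\<beta> j t) (z (fst (b j t), Suc (snd (b j t))))"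
    "\<And>j s t. s \<in> T \<Longrightarrow> t \<in> T \<Longrightarrow> R p s t \<Longrightarrow> R p (\<beta> j s) (\<beta> j t)"
    by metis
  have "\<exists>f\<in>Aut R. f p = p \<and> (\<forall>t\<in>T. f t = \<alpha> i t)" for i
    using T \<alpha>(2) \<alpha>(1)[of _ i, THEN conjunct1, THEN distinct_of]
    by (intro extend_increasing_map) auto
  then obtain f where f: "\<And>i. f i \<in> stabilizer p" "\<And>i t. t \<in> T \<Longrightarrow> f i t = \<alpha> i t"
    unfolding stabilizer_def by simp metis
  have "\<exists>h\<in>Aut R. h p = p \<and> (\<forall>t\<in>T. h t = \<beta> j t)" for j
    using T \<beta>(2) \<beta>(1)[of _ j, THEN conjunct1, THEN distinct_of]
    by (intro extend_increasing_map) auto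
  then obtain h where h: "\<And>i. h i \<in> stabilizer p" "\<And>i t. t \<in> T \<Longrightarrow> h i t = \<beta> i t"
    unfolding stabilizer_def by simp metis
  define g where "g i = inv_into UNIV (f i)" for i
  have g: "g i \<in> stabilizer p" "g i (f i x) = x" for i x
    using stabilizer_inv[OF f(1)] Aut_inv(5)[of "f i" R x] f(1)[of i]
    by (auto simp: g_def stabilizer_def)
  have "g i \<circ> h j \<in> merge_pattern p T r (if i \<le> j then Suc k else k)" for i j
  proof -
    define m where "m = (if i \<le> j then Suc k else k)"
    have "if max (r s) m \<le> max (r t) m then R p s ((g i \<circ> h j) t) else R p ((g i \<circ> h j) t) s"
      if st: "s \<in> T" "t \<in> T" for s t
    proof -
      have iff: "R p s ((g i \<circ> h j) t) \<longleftrightarrow> R p (\<alpha> i s) (\<beta> j t)"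
        "R p ((g i \<circ> h j) t) s \<longleftrightarrow> R p (\<beta> j t) (\<alpha> i s)"
        using stabilizer_increasing[OF g(1), of i "\<alpha> i s" "\<beta> j t"]
          stabilizer_increasing[OF g(1), of i "\<beta> j t" "\<alpha> i s"] g(2)[of i s] f(2)[OF st(1)] h(2)[OF st(2)]
        by simp_all
      have "if max (r s) m \<le> max (r t) m then slot_less (a i s) (b j t) else slot_less (b j t) (a i s)"
        unfolding m_def a_def b_def slot_less_def by auto
      then show ?thesis
        unfolding iff using slots_separate[where p=p and z=z, OF z] \<alpha>(1)[OF st(1), of i] \<beta>(1)[OF st(2), of j]
        by (auto split: if_splits)
    qed
    then have "g i \<circ> h j \<in> merge_pattern p T r m"
      using stabilizer_comp[OF g(1) h(1)] unfolding merge_pattern_def pattern_def by blast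
    then show ?thesis unfolding m_def .
  qed
  then show ?thesis using g(1) h(1) by blast
qed

section \<open>Constancy of weakly almost periodic functions\<close>

text \<open>
  What is used of a weakly almost periodic function. The name refers to model theory, where the
  order property excluded by commuting iterated limits is the negation of stability.
\<close>

definition stable :: "(('a \<Rightarrow> 'a) \<Rightarrow> complex) \<Rightarrow> bool" where
  "stable \<phi> \<longleftrightarrow> continuous_map (aut_topology R) euclidean \<phi> \<and>
     (\<exists>M. \<forall>g\<in>Aut R. norm (\<phi> g) \<le> M) \<and>
     iterated_limits_commute (Aut R) (Aut R) (\<lambda>g h. \<phi> (g \<circ> h))"

lemma stable_translate:
  assumes "stable \<phi>" and h: "h \<in> Aut R"
  shows "stable (\<lambda>g. \<phi> (h \<circ> g))"
proof -
  have "continuous_map (aut_topology R) euclidean (\<phi> \<circ> (\<lambda>g. h \<circ> g))"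
    using continuous_map_compose[OF continuous_map_comp_left[OF h]] assms(1)
    by (auto simp: stable_def)
  then have "continuous_map (aut_topology R) euclidean (\<lambda>g. \<phi> (h \<circ> g))"
    by (simp add: comp_def)
  moreover have "\<exists>M. \<forall>g\<in>Aut R. norm (\<phi> (h \<circ> g)) \<le> M"
    using assms Aut_comp[OF h] unfolding stable_def by blast
  moreover have "iterated_limits_commute (Aut R) (Aut R) (\<lambda>g k. \<phi> (h \<circ> (g \<circ> k)))"
    unfolding iterated_limits_commute_def
  proof (intro allI impI)
    fix U x y a b c d
    assume *: "free_ultrafilter U" "range x \<subseteq> Aut R" "range y \<subseteq> Aut R"
      "\<forall>i. ((\<lambda>j. \<phi> (h \<circ> (x i \<circ> y j))) \<longlongrightarrow> a i) U" "\<forall>j. ((\<lambda>i. \<phi> (h \<circ> (x i \<circ> y j))) \<longlongrightarrow> b j) U"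
      "(a \<longlongrightarrow> c) U" "(b \<longlongrightarrow> d) U"
    have comm: "iterated_limits_commute (Aut R) (Aut R) (\<lambda>g h. \<phi> (g \<circ> h))"
      using assms(1) by (simp add: stable_def)
    have xy: "x i \<in> Aut R" "y i \<in> Aut R" for i using *(2,3) by auto
    show "c = d"
      by (rule iterated_limits_commuteD[OF comm *(1) _ _ _ _ *(6,7), of "\<lambda>i. h \<circ> x i" y])
         (use *(4,5) xy in \<open>simp_all add: comp_assoc Aut_comp[OF h]\<close>)
  qed
  ultimately show ?thesis by (simp add: stable_def)
qed

text \<open>
  Two-sided uniform continuity with error \<open>\<delta>\<close>, witnessed by the neighbourhood that \<open>T\<close> defines.
\<close>

definition controls :: "'a \<Rightarrow> (('a \<Rightarrow> 'a) \<Rightarrow> complex) \<Rightarrow> real \<Rightarrow> 'a set \<Rightarrow> bool" where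
  "controls p \<phi> \<delta> T \<longleftrightarrow> finite T \<and> p \<notin> T \<and>
     (\<forall>v\<in>nearly_fixing p T. \<forall>g\<in>Aut R.
        norm (\<phi> (v \<circ> g) - \<phi> g) < \<delta> \<and> norm (\<phi> (g \<circ> v) - \<phi> g) < \<delta>)"

lemma controls_superset:
  assumes "controls p \<phi> \<delta> S" "S \<subseteq> T" "finite T" "p \<notin> T"
  shows "controls p \<phi> \<delta> T"
proof -
  have "nearly_fixing p T \<subseteq> nearly_fixing p S"
    using assms(2) unfolding nearly_fixing_def by blast
  then show ?thesis using assms unfolding controls_def by blast
qed

text \<open>
  Left and right translations are two instances of \<open>uniform_continuity_at_some_point\<close>; in each the
  exceptional point is removed by multiplying with its inverse.
\<close>

lemma stable_uniformly_continuous: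
  assumes "stable \<phi>" "\<delta> > 0"
  shows "\<exists>T. controls p \<phi> \<delta> T"
proof -
  let ?N = "nhdsin (aut_topology R) id"
  have cont: "continuous_map (aut_topology R) euclidean \<phi>"
    and comm: "iterated_limits_commute (Aut R) (Aut R) (\<lambda>g h. \<phi> (g \<circ> h))"
    using assms(1) by (auto simp: stable_def)
  obtain M where M: "\<And>g. g \<in> Aut R \<Longrightarrow> norm (\<phi> g) \<le> M"
    using assms(1) by (auto simp: stable_def)
  have in_Aut: "eventually (\<lambda>v. v \<in> Aut R) ?N"
    unfolding eventually_nhdsin
    by (intro disjI2 exI[of _ "Aut R"]) (simp add: Aut_id openin_topspace[of "aut_topology R", unfolded topspace_aut])
  have "\<exists>x\<in>Aut R. eventually (\<lambda>v. \<forall>y\<in>Aut R. norm (\<phi> ((v \<circ> x) \<circ> y) - \<phi> (x \<circ> y)) < \<delta>) ?N"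
  proof (rule uniform_continuity_at_some_point[OF comm])
    show "eventually (\<lambda>v. \<forall>x\<in>Aut R. v \<circ> x \<in> Aut R) ?N"
      using in_Aut by eventually_elim (auto intro: Aut_comp)
    show "((\<lambda>v. \<phi> ((v \<circ> x) \<circ> y)) \<longlongrightarrow> \<phi> (x \<circ> y)) ?N" if "x \<in> Aut R" "y \<in> Aut R" for x y
      using tendsto_nhdsin_id[OF cont continuous_map_comp_right[OF Aut_comp[OF that]]]
      by (simp add: comp_assoc)
  qed (auto intro: M Aut_comp Aut_id assms)
  then obtain x where x: "x \<in> Aut R"
    and left: "eventually (\<lambda>v. \<forall>y\<in>Aut R. norm (\<phi> ((v \<circ> x) \<circ> y) - \<phi> (x \<circ> y)) < \<delta>) ?N"
    by blast
  have "\<exists>x\<in>Aut R. eventually (\<lambda>v. \<forall>y\<in>Aut R. norm (\<phi> (y \<circ> (x \<circ> v)) - \<phi> (y \<circ> x)) < \<delta>) ?N"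
  proof (rule uniform_continuity_at_some_point[OF iterated_limits_commute_swap[OF comm]])
    show "eventually (\<lambda>v. \<forall>x\<in>Aut R. x \<circ> v \<in> Aut R) ?N"
      using in_Aut by eventually_elim (auto intro: Aut_comp)
    show "((\<lambda>v. \<phi> (y \<circ> (x \<circ> v))) \<longlongrightarrow> \<phi> (y \<circ> x)) ?N" if "x \<in> Aut R" "y \<in> Aut R" for x y
      using tendsto_nhdsin_id[OF cont continuous_map_comp_left[OF Aut_comp[OF that(2,1)]]]
      by (simp add: comp_assoc)
  qed (auto intro: M Aut_comp Aut_id assms)
  then obtain x' where x': "x' \<in> Aut R"
    and right: "eventually (\<lambda>v. \<forall>y\<in>Aut R. norm (\<phi> (y \<circ> (x' \<circ> v)) - \<phi> (y \<circ> x')) < \<delta>) ?N"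
    by blast
  have "eventually (\<lambda>v. \<forall>g\<in>Aut R. norm (\<phi> (v \<circ> g) - \<phi> g) < \<delta> \<and> norm (\<phi> (g \<circ> v) - \<phi> g) < \<delta>) ?N"
    using left right
  proof eventually_elim
    case (elim v)
    show ?case
    proof
      fix g assume g: "g \<in> Aut R"
      have "x \<circ> (inv_into UNIV x \<circ> g) = g" "v \<circ> x \<circ> (inv_into UNIV x \<circ> g) = v \<circ> g"
        "(g \<circ> inv_into UNIV x') \<circ> x' = g" "(g \<circ> inv_into UNIV x') \<circ> (x' \<circ> v) = g \<circ> v"
        by (auto simp: fun_eq_iff Aut_inv(4)[OF x] Aut_inv(5)[OF x'])
      moreover have "inv_into UNIV x \<circ> g \<in> Aut R" "g \<circ> inv_into UNIV x' \<in> Aut R"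
        by (intro Aut_comp Aut_inv(1) x x' g)+
      ultimately show "norm (\<phi> (v \<circ> g) - \<phi> g) < \<delta> \<and> norm (\<phi> (g \<circ> v) - \<phi> g) < \<delta>"
        using elim by metis
    qed
  qed
  from nearly_fixing_neighbourhood[OF this, of p] show ?thesis unfolding controls_def by blast
qed

text \<open>
  If \<open>g\<close> and \<open>g'\<close> have the same pattern, the map that fixes \<open>T\<close> and sends \<open>g t\<close> to \<open>g' t\<close> is increasing
  on \<open>T \<union> g T\<close>, so it extends to an automorphism \<open>v\<close>. Then \<open>g' = v \<circ> g \<circ> w\<close> where both \<open>v\<close> and \<open>w\<close> fix
  \<open>T\<close> pointwise: a nonempty pattern is a double coset of the pointwise stabilizer of \<open>T\<close> and \<open>p\<close>.
\<close>

lemma same_pattern_close: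
  assumes T: "controls p \<phi> \<delta> T" and g: "g \<in> pattern p T \<omega>" and g': "g' \<in> pattern p T \<omega>"
  shows "norm (\<phi> g - \<phi> g') \<le> 2 * \<delta>"
proof -
  have gA: "g \<in> Aut R" "g p = p" "g' \<in> Aut R" "g' p = p"
    using g g' by (auto simp: pattern_def stabilizer_def)
  have gs: "g \<in> stabilizer p" "g' \<in> stabilizer p" using g g' by (auto simp: pattern_def)
  have fin: "finite T" "p \<notin> T" using T by (auto simp: controls_def)
  have inv_g: "inv_into UNIV g (g t) = t" for t using Aut_inv(5)[OF gA(1)] .
  have disj: "g t \<notin> T" if "t \<in> T" for t
  proof
    assume "g t \<in> T"
    then have "R p (g t) (g t)" using g that unfolding pattern_def by (auto split: if_splits)
    then show False using from_asym by blast
  qed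
  have iff: "R p s (g t) \<longleftrightarrow> R p s (g' t)" "R p (g t) s \<longleftrightarrow> R p (g' t) s" if "s \<in> T" "t \<in> T" for s t
    using g g' that from_asym unfolding pattern_def by (auto split: if_splits) metis+
  \<comment> \<open>On \<open>g T\<close>, which is disjoint from \<open>T\<close>, this is the map sending \<open>g t\<close> to \<open>g' t\<close>.\<close>
  define \<sigma> where "\<sigma> x = (if x \<in> T then x else g' (inv_into UNIV g x))" for x
  have \<sigma>: "\<sigma> t = t" "\<sigma> (g t) = g' t" if "t \<in> T" for t
    using that disj inv_g by (auto simp: \<sigma>_def)
  have "\<exists>v\<in>Aut R. v p = p \<and> (\<forall>x\<in>T \<union> g ` T. v x = \<sigma> x)"
  proof (rule extend_increasing_map)
    show "finite (T \<union> g ` T)" using fin by simp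
    show "p \<notin> T \<union> g ` T" using fin(2) gA inv_g by (metis Un_iff imageE)
    show "\<sigma> x \<noteq> p" if x: "x \<in> T \<union> g ` T" for x
    proof
      assume "\<sigma> x = p"
      moreover obtain t where t: "t \<in> T" "x = t \<or> x = g t" using x by blast
      ultimately have "t = p \<or> g' t = p" using \<sigma> by auto
      then have "t = p" using Aut_inv(5)[OF gA(3)] gA(4) by metis
      then show False using fin(2) t(1) by simp
    qed
    show "R p (\<sigma> x) (\<sigma> y)" if "x \<in> T \<union> g ` T" "y \<in> T \<union> g ` T" "R p x y" for x y
      using that \<sigma> iff stabilizer_increasing[OF gs(1)] stabilizer_increasing[OF gs(2)] by auto
  qed
  then obtain v where v: "v \<in> Aut R" "v p = p" "\<And>t. t \<in> T \<Longrightarrow> v t = t" "\<And>t. t \<in> T \<Longrightarrow> v (g t) = g' t"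
    using \<sigma> by auto
  then have vN: "v \<in> nearly_fixing p T" by (auto simp: nearly_fixing_def)
  define w where "w = inv_into UNIV (v \<circ> g) \<circ> g'"
  have vg: "v \<circ> g \<in> stabilizer p" using v gA by (simp add: stabilizer_def Aut_comp)
  have "w \<in> stabilizer p"
    unfolding w_def by (intro stabilizer_comp stabilizer_inv vg gs)
  moreover have "w t = t" if "t \<in> T" for t
    using Aut_inv(5)[of "v \<circ> g" R t] vg v(4)[OF that] by (simp add: w_def stabilizer_def)
  ultimately have wN: "w \<in> nearly_fixing p T" by (auto simp: nearly_fixing_def stabilizer_def)
  have "v \<circ> g \<circ> w = g'"
    using Aut_inv(4)[of "v \<circ> g" R] vg by (auto simp: w_def stabilizer_def fun_eq_iff)
  then have "norm (\<phi> g' - \<phi> (v \<circ> g)) < \<delta>"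
    using T wN Aut_comp[OF v(1) gA(1)] unfolding controls_def by metis
  moreover have "norm (\<phi> (v \<circ> g) - \<phi> g) < \<delta>" using T vN gA(1) unfolding controls_def by blast
  ultimately show ?thesis
    using norm_triangle_ineq[of "\<phi> g' - \<phi> (v \<circ> g)" "\<phi> (v \<circ> g) - \<phi> g"]
    by (simp add: norm_minus_commute)
qed

lemma merge_step_close:
  assumes "stable \<phi>" and T: "controls p \<phi> \<delta> T"
    and r: "\<And>s t. s \<in> T \<Longrightarrow> t \<in> T \<Longrightarrow> R p s t \<Longrightarrow> r s \<le> r t"
    and x: "x \<in> merge_pattern p T r k" and y: "y \<in> merge_pattern p T r (Suc k)"
  shows "norm (\<phi> y - \<phi> x) \<le> 4 * \<delta>"
proof -
  obtain M where M: "\<And>g. g \<in> Aut R \<Longrightarrow> norm (\<phi> g) \<le> M"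
    using assms(1) by (auto simp: stable_def)
  have fin: "finite T" "p \<notin> T" using T by (auto simp: controls_def)
  obtain g h :: "nat \<Rightarrow> 'a \<Rightarrow> 'a" where gh: "\<And>i. g i \<in> stabilizer p" "\<And>i. h i \<in> stabilizer p"
    and pat: "\<And>i j. g i \<circ> h j \<in> merge_pattern p T r (if i \<le> j then Suc k else k)"
    using merge_step_sequences[of T p r k, OF fin r] by blast
  have "norm (\<phi> y - \<phi> x) \<le> 2 * (2 * \<delta>)"
  proof (rule order_pattern_collapse)
    show "iterated_limits_commute (Aut R) (Aut R) (\<lambda>g h. \<phi> (g \<circ> h))"
      using assms(1) by (simp add: stable_def)
    show "norm (\<phi> (g \<circ> h)) \<le> M" if "g \<in> Aut R" "h \<in> Aut R" for g h
      using M Aut_comp[OF that] by blast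
    show "g i \<in> Aut R" "h i \<in> Aut R" for i using gh by (auto simp: stabilizer_def)
    show "norm (\<phi> (g i \<circ> h j) - \<phi> y) \<le> 2 * \<delta>" if "i \<le> j" for i j
      using pat[of i j] y that T same_pattern_close unfolding merge_pattern_def by auto
    show "norm (\<phi> (g i \<circ> h j) - \<phi> x) \<le> 2 * \<delta>" if "j < i" for i j
      using pat[of i j] x that T same_pattern_close unfolding merge_pattern_def by auto
  qed
  then show ?thesis by simp
qed

lemma merge_pattern_nonempty:
  assumes "finite T" "p \<notin> T" "\<And>s t. s \<in> T \<Longrightarrow> t \<in> T \<Longrightarrow> R p s t \<Longrightarrow> r s \<le> r t"
  shows "\<exists>x. x \<in> merge_pattern p T r k"
proof -
  obtain g h :: "nat \<Rightarrow> 'a \<Rightarrow> 'a" where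
    "\<And>i j. g i \<circ> h j \<in> merge_pattern p T r (if i \<le> j then Suc k else k)"
    using merge_step_sequences[of T p r k, OF assms] by blast
  from this[of 1 0] show ?thesis by auto
qed

lemma merge_chain_close:
  assumes "stable \<phi>" and T: "controls p \<phi> \<delta> T"
    and r: "\<And>s t. s \<in> T \<Longrightarrow> t \<in> T \<Longrightarrow> R p s t \<Longrightarrow> r s \<le> r t"
    and x: "x \<in> merge_pattern p T r 0" and y: "y \<in> merge_pattern p T r k"
  shows "norm (\<phi> y - \<phi> x) \<le> (4 * real k + 2) * \<delta>"
  using y
proof (induction k arbitrary: y)
  case 0
  then show ?case using same_pattern_close[OF T] x unfolding merge_pattern_def by simp
next
  case (Suc k)
  have "finite T" "p \<notin> T" using T by (auto simp: controls_def)
  then obtain w where w: "w \<in> merge_pattern p T r k"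
    using merge_pattern_nonempty[of T p r k] r by blast
  have "norm (\<phi> y - \<phi> x) \<le> norm (\<phi> y - \<phi> w) + norm (\<phi> w - \<phi> x)"
    using norm_triangle_ineq[of "\<phi> y - \<phi> w" "\<phi> w - \<phi> x"] by simp
  also have "\<dots> \<le> 4 * \<delta> + (4 * real k + 2) * \<delta>"
    by (intro add_mono Suc.IH w merge_step_close[OF assms(1) T r w Suc.prems])
  finally show ?case by (simp add: algebra_simps)
qed

text \<open>
  Uniform continuity is used at two scales. The coarse set \<open>F\<close> fixes the number of exchanges of blocks,
  and the fine set \<open>T\<close> is chosen afterwards so that all exchanges together cost at most \<open>\<epsilon> / 2\<close>. The block
  number \<open>r\<close> counts the points of \<open>F\<close> up to a given point.
\<close>

lemma value_at_identity_is_limit: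
  assumes "stable \<phi>" "\<epsilon> > 0"
  shows "\<exists>T. finite T \<and> p \<notin> T \<and> (\<forall>g\<in>stabilizer p.
    (\<forall>s\<in>T. \<forall>t\<in>T. R p s (g t)) \<longrightarrow> norm (\<phi> g - \<phi> id) < \<epsilon>)"
proof -
  obtain F where F: "controls p \<phi> (\<epsilon> / 2) F"
    using stable_uniformly_continuous[OF assms(1), of "\<epsilon> / 2"] assms(2) by auto
  then have finF: "finite F" "p \<notin> F" by (auto simp: controls_def)
  define n where "n = card F"
  \<comment> \<open>There are \<open>n\<close> exchanges at cost \<open>4 * \<delta>\<close> each, and \<open>2 * \<delta>\<close> for comparing two starting elements.\<close>
  define \<delta> where "\<delta> = \<epsilon> / (8 * (real n + 1))"
  have "\<delta> > 0" using assms(2) by (simp add: \<delta>_def)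
  obtain T' where T': "controls p \<phi> \<delta> T'"
    using stable_uniformly_continuous[OF assms(1) \<open>\<delta> > 0\<close>] by blast
  define T where "T = T' \<union> F"
  have T: "controls p \<phi> \<delta> T"
    using T' finF by (intro controls_superset[OF T']) (auto simp: T_def controls_def)
  then have finT: "finite T" "p \<notin> T" by (auto simp: controls_def)
  define r where "r t = card {f \<in> F. f = t \<or> R p f t}" for t
  have r: "r s \<le> r t" if "R p s t" for s t
    unfolding r_def using finF(1) that from_trans by (intro card_mono) auto
  have rn: "r t \<le> n" for t
    unfolding r_def n_def using finF(1) by (intro card_mono) auto
  \<comment> \<open>A point of \<open>F\<close> starts a new block, so images of smaller points stay below it.\<close>
  have r_less: "r s < r t" if "t \<in> F" "R p s t" for s t
  proof -
    have "t \<noteq> s" "\<not> R p t s" using that distinct_of from_asym by blast+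
    then have "{f \<in> F. f = s \<or> R p f s} \<subset> {f \<in> F. f = t \<or> R p f t}"
      using that from_trans by auto
    then show ?thesis unfolding r_def using finF(1) by (intro psubset_card_mono) auto
  qed
  obtain x where x: "x \<in> merge_pattern p T r 0"
    using merge_pattern_nonempty[of T p r 0] finT r by blast
  have "x \<in> nearly_fixing p F"
  proof -
    have "R p (x s) t \<and> R p s (x t)" if "s \<in> F" "t \<in> F" "R p s t" for s t
      using x r[OF that(3)] r_less[OF that(2,3)] that(1,2)
      unfolding merge_pattern_def pattern_def T_def by (auto simp: not_le[symmetric])
    then show ?thesis using x by (auto simp: merge_pattern_def pattern_def stabilizer_def nearly_fixing_def)
  qed
  then have "norm (\<phi> (x \<circ> id) - \<phi> id) < \<epsilon> / 2"
    using F Aut_id unfolding controls_def by blast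
  then have x_id: "norm (\<phi> x - \<phi> id) < \<epsilon> / 2" by simp
  have "norm (\<phi> g - \<phi> id) < \<epsilon>" if "g \<in> stabilizer p" "\<forall>s\<in>T. \<forall>t\<in>T. R p s (g t)" for g
  proof -
    have "g \<in> merge_pattern p T r n"
      using that rn unfolding merge_pattern_def pattern_def by (simp add: max_absorb2)
    then have "norm (\<phi> g - \<phi> x) \<le> (4 * real n + 2) * \<delta>"
      using merge_chain_close[OF assms(1) T r x] by blast
    also have "\<dots> \<le> (4 * real n + 4) * \<delta>" using \<open>\<delta> > 0\<close> by (intro mult_right_mono) auto
    also have "\<dots> = \<epsilon> / 2" unfolding \<delta>_def by (simp add: field_simps)
    finally show ?thesis
      using x_id norm_triangle_ineq[of "\<phi> g - \<phi> x" "\<phi> x - \<phi> id"] by simp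
  qed
  with finT show ?thesis by blast
qed

text \<open>
  An element \<open>g\<close> that pushes a set containing \<open>S\<close> and its preimage under \<open>h\<close> above itself yields an
  \<open>h \<circ> g\<close> that pushes \<open>S\<close> above itself. So \<open>\<phi> (h \<circ> g)\<close> approximates \<open>\<phi> id\<close>, and also
  \<open>\<phi> h\<close> when the limit is taken for the translate of \<open>\<phi>\<close> by \<open>h\<close>.
\<close>

lemma stable_constant_on_stabilizer:
  assumes "stable \<phi>" and h: "h \<in> stabilizer p"
  shows "\<phi> h = \<phi> id"
proof -
  have hA: "h \<in> Aut R" using h by (simp add: stabilizer_def)
  have "norm (\<phi> h - \<phi> id) \<le> \<epsilon>" if "\<epsilon> > 0" for \<epsilon>
  proof -
    have e2: "\<epsilon> / 2 > 0" using that by simp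
    obtain S where S: "finite S" "p \<notin> S"
      "\<And>g. g \<in> stabilizer p \<Longrightarrow> \<forall>s\<in>S. \<forall>t\<in>S. R p s (g t) \<Longrightarrow> norm (\<phi> g - \<phi> id) < \<epsilon> / 2"
      using value_at_identity_is_limit[OF assms(1) e2, of p] by blast
    obtain S' where S': "finite S'" "p \<notin> S'"
      "\<And>g. g \<in> stabilizer p \<Longrightarrow> \<forall>s\<in>S'. \<forall>t\<in>S'. R p s (g t) \<Longrightarrow> norm (\<phi> (h \<circ> g) - \<phi> (h \<circ> id)) < \<epsilon> / 2"
      using value_at_identity_is_limit[OF stable_translate[OF assms(1) hA] e2, of p] by blast
    define k where "k = inv_into UNIV h"
    have k: "k \<in> stabilizer p" "\<And>x. h (k x) = x"
      using stabilizer_inv[OF h] Aut_inv(4)[OF hA] by (auto simp: k_def)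
    define A where "A = S \<union> S' \<union> k ` S"
    have "p \<notin> k ` S" using S(2) k h unfolding stabilizer_def by (metis (mono_tags, lifting) imageE mem_Collect_eq)
    then have A: "finite A" "p \<notin> A" using S(1,2) S'(1,2) by (auto simp: A_def)
    obtain u where u: "u \<noteq> p" "\<forall>s\<in>A. R p s u" using finite_upper_bound[OF A] by blast
    obtain v where v: "R p u v" using from_unbounded(1)[OF u(1)] by blast
    obtain \<sigma> where \<sigma>: "\<forall>t\<in>A. R p u (\<sigma> t) \<and> R p (\<sigma> t) v"
      "\<forall>s\<in>A. \<forall>t\<in>A. R p s t \<longrightarrow> R p (\<sigma> s) (\<sigma> t)"
      using copy_into_interval[OF v A] by blast
    have "\<exists>g\<in>Aut R. g p = p \<and> (\<forall>t\<in>A. g t = \<sigma> t)"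
      using A \<sigma> distinct_of by (intro extend_increasing_map) blast+
    then obtain g where g: "g \<in> stabilizer p" "\<And>t. t \<in> A \<Longrightarrow> g t = \<sigma> t"
      unfolding stabilizer_def by blast
    have up: "R p s (g t)" if "s \<in> A" "t \<in> A" for s t
      using u(2) \<sigma>(1) g(2) that from_trans by metis
    have "\<forall>s\<in>S'. \<forall>t\<in>S'. R p s (g t)" using up by (auto simp: A_def)
    then have 1: "norm (\<phi> (h \<circ> g) - \<phi> h) < \<epsilon> / 2" using S'(3)[OF g(1)] by simp
    have "R p s ((h \<circ> g) t)" if "s \<in> S" "t \<in> S" for s t
      using stabilizer_increasing[OF h, of "k s" "g t"] up[of "k s" t] that k(2) by (simp add: A_def)
    then have 2: "norm (\<phi> (h \<circ> g) - \<phi> id) < \<epsilon> / 2"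
      using S(3)[OF stabilizer_comp[OF h g(1)]] by blast
    show ?thesis
      using 1 2 norm_triangle_ineq4[of "\<phi> (h \<circ> g) - \<phi> id" "\<phi> (h \<circ> g) - \<phi> h"] by simp
  qed
  then have "norm (\<phi> h - \<phi> id) \<le> 0" by (rule field_le_epsilon[of _ 0, simplified])
  then show ?thesis by simp
qed

text \<open>
  The map \<open>h\<close> is a product \<open>k \<circ> l\<close> of automorphisms with fixed points: \<open>k\<close> fixes some \<open>y\<close> and agrees with
  \<open>h\<close> at \<open>x\<close>, so that \<open>l\<close> fixes \<open>x\<close>.
\<close>

lemma stable_constant:
  assumes "stable \<phi>" and h: "h \<in> Aut R"
  shows "\<phi> h = \<phi> id"
proof -
  obtain x :: 'a where True by blast
  obtain y where y: "y \<noteq> x" "y \<noteq> h x" using three_points by metis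
  have "\<exists>k\<in>Aut R. k y = y \<and> (\<forall>t\<in>{x}. k t = h x)"
    using y from_asym by (intro extend_increasing_map) auto
  then obtain k where k: "k \<in> stabilizer y" "k x = h x" unfolding stabilizer_def by blast
  then have kA: "k \<in> Aut R" by (simp add: stabilizer_def)
  define l where "l = inv_into UNIV k \<circ> h"
  have "l \<in> stabilizer x"
    using Aut_comp[OF Aut_inv(1)[OF kA] h] Aut_inv(5)[OF kA, of x] k(2)
    by (simp add: l_def stabilizer_def)
  then have "\<phi> (k \<circ> l) = \<phi> (k \<circ> id)"
    by (rule stable_constant_on_stabilizer[OF stable_translate[OF assms(1) kA]])
  moreover have "k \<circ> l = h" using Aut_inv(4)[OF kA] by (auto simp: l_def)
  moreover have "\<phi> k = \<phi> id" by (rule stable_constant_on_stabilizer[OF assms(1) k(1)])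
  ultimately show ?thesis by simp
qed

lemma WAP_stable:
  assumes "\<phi> \<in> WAP (aut_group R) (aut_topology R)"
  shows "stable \<phi>"
proof -
  have \<phi>: "continuous_map (aut_topology R) euclidean \<phi>" "bounded (\<phi> ` Aut R)"
    using assms by (auto simp: WAP_def Cb_def topspace_aut)
  obtain M where M: "\<And>g. g \<in> Aut R \<Longrightarrow> norm (\<phi> g) \<le> M"
    using \<phi>(2) unfolding bounded_iff by auto
  have "translate (aut_group R) g \<phi> \<in> Cb (aut_topology R)" if g: "g \<in> Aut R" for g
  proof -
    have "continuous_map (aut_topology R) euclidean (\<phi> \<circ> (\<lambda>h. g \<circ> h))"
      using continuous_map_comp_left[OF g] \<phi>(1) by (rule continuous_map_compose)
    then have "continuous_map (aut_topology R) euclidean (translate (aut_group R) g \<phi>)"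
      by (rule continuous_map_eq) (simp add: translate_def aut_group_def topspace_aut)
    moreover have "bounded (translate (aut_group R) g \<phi> ` Aut R)"
      unfolding bounded_iff using M Aut_comp[OF g]
      by (intro exI[of _ M]) (auto simp: translate_def aut_group_def)
    ultimately show ?thesis
      by (simp add: Cb_def topspace_aut translate_def aut_group_def)
  qed
  then have "iterated_limits_commute (carrier (aut_group R)) (carrier (aut_group R))
      (\<lambda>g h. \<phi> (g \<otimes>\<^bsub>aut_group R\<^esub> h))"
    by (intro WAP_iterated_limits_commute[OF assms topspace_aut_topology])
       (simp add: aut_group_def)
  then show ?thesis using \<phi>(1) M unfolding stable_def by (auto simp: aut_group_def)
qed

lemma WAP_constants:
  "WAP (aut_group R) (aut_topology R) = {\<lambda>h\<in>Aut R. c | c. True}"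
proof
  show "{\<lambda>h\<in>Aut R. c | c. True} \<subseteq> WAP (aut_group R) (aut_topology R)"
    using constants_in_WAP[OF topspace_aut_topology] Aut_comp
    by (auto simp: aut_group_def topspace_aut)
  show "WAP (aut_group R) (aut_topology R) \<subseteq> {\<lambda>h\<in>Aut R. c | c. True}"
  proof
    fix \<phi> assume \<phi>: "\<phi> \<in> WAP (aut_group R) (aut_topology R)"
    then have "\<phi> \<in> extensional (Aut R)" by (simp add: WAP_def Cb_def topspace_aut)
    then have "\<phi> = (\<lambda>h\<in>Aut R. \<phi> id)"
      using stable_constant[OF WAP_stable[OF \<phi>]] by (intro extensionalityI[of _ "Aut R"]) auto
    then show "\<phi> \<in> {\<lambda>h\<in>Aut R. c | c. True}" by blast
  qed
qed

end

section \<open>Triviality of the compactification\<close>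

theorem theorem4:
  fixes R :: "'a \<Rightarrow> 'a \<Rightarrow> 'a \<Rightarrow> bool"
  assumes "cyclic_order R"
    and "infinite (UNIV :: 'a set)"
    and "ultrahomogeneous R"
  shows "\<exists>p. topspace (WAP_compactification (aut_group R) (aut_topology R)) = {p}"
proof -
  interpret ultrahomogeneous_cyclic_order R
    using assms(1,3) by (intro ultrahomogeneous_cyclic_order.intro ultrahomogeneous_cyclic_order_axioms.intro)
  have "characters (Aut R) (WAP (aut_group R) (aut_topology R)) =
      {\<lambda>\<phi>\<in>WAP (aut_group R) (aut_topology R). \<phi> id}"
    by (rule characters_of_constants[OF WAP_constants Aut_id])
  then have "topspace (WAP_compactification (aut_group R) (aut_topology R)) =
      {\<lambda>\<phi>\<in>WAP (aut_group R) (aut_topology R). \<phi> id}"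
    by (auto simp: WAP_compactification_def gelfand_space_def topspace_aut characters_def)
  then show ?thesis by blast
qed

end
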